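(* Let $k\ge1$ be an integer, $0<\epsilon<1$, and for $t\in\mathbb{R}$ let $P_t\in B(H^2_2)$ be the orthogonal projection of $H^2_2$ onto the orthogonal complement $\langle z_1^k-\epsilon e^{it}\rangle^\perp$ of the principal ideal generated by $z_1^k-\epsilon e^{it}$ in $\mathbb{C}[z_1,z_2]$. Then the map $P:\mathbb{R}\to B(H^2_2)$, $t\mapsto P_t$, does not have a bounded derivative; that is, $P$ is not differentiable as a map from $\mathbb{R}$ to the Banach space $B(H^2_2)$ with derivative $\dot P_t\in B(H^2_2)$.
   Context: $H^2_2$ is the Drury-Arveson space on the unit ball $\mathbb{B}^2\subset\mathbb{C}^2$: the Hilbert space of analytic functions in which distinct monomials are orthogonal and $\|z_1^mz_2^n\|^2=\binom{m+n}{m}^{-1}$. $B(H^2_2)$ is the Banach space of bounded linear operators on $H^2_2$ with the operator norm. *)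

theory Defs
  imports "HOL-Analysis.Analysis" "HOL-Computational_Algebra.Polynomial"
begin

section \<open>The Drury--Arveson space in two variables\<close>

text \<open>
  The unit ball of \<open>\<complex>\<^sup>2\<close> is \<^term>\<open>ball (0 :: complex \<times> complex) 1\<close>; the library norm on the
  product type is the Euclidean one.  A pair \<open>(m, n)\<close> is the exponent of \<open>z\<^sub>1\<^sup>m z\<^sub>2\<^sup>n\<close>.
\<close>

definition mono_weight :: "nat \<times> nat \<Rightarrow> real" where
  "mono_weight = (\<lambda>(m, n). real ((m + n) choose m))"

definition mono_eval :: "nat \<times> nat \<Rightarrow> complex \<times> complex \<Rightarrow> complex" where
  "mono_eval = (\<lambda>(m, n) (z1, z2). z1 ^ m * z2 ^ n)"

definition has_power_expansion ::
  "(complex \<times> complex \<Rightarrow> complex) \<Rightarrow> (nat \<times> nat \<Rightarrow> complex) \<Rightarrow> bool" where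
  "has_power_expansion f a \<longleftrightarrow>
     (\<forall>z\<in>ball 0 1. ((\<lambda>i. a i * mono_eval i z) has_sum f z) UNIV)"

definition weighted_l2 :: "(nat \<times> nat \<Rightarrow> complex) \<Rightarrow> bool" where
  "weighted_l2 a \<longleftrightarrow> (\<lambda>i. (cmod (a i))\<^sup>2 / mono_weight i) summable_on UNIV"

text \<open>
  Elements are analytic functions on the ball, represented as total functions that vanish
  outside it, so that equality of representatives is equality on the ball.
\<close>

typedef drury_arveson =
  "{f :: complex \<times> complex \<Rightarrow> complex.
      (\<forall>z. z \<notin> ball 0 1 \<longrightarrow> f z = 0) \<and> (\<exists>a. has_power_expansion f a \<and> weighted_l2 a)}"
  morphisms da_eval Abs_da
proof (rule exI[of _ "\<lambda>_. 0"], clarsimp, rule exI[of _ "\<lambda>_. 0"], intro conjI)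
qed (auto simp: has_power_expansion_def weighted_l2_def)

setup_lifting type_definition_drury_arveson

definition power_coeff :: "(complex \<times> complex \<Rightarrow> complex) \<Rightarrow> nat \<times> nat \<Rightarrow> complex" where
  "power_coeff f = (THE a. has_power_expansion f a)"

definition da_coeff :: "drury_arveson \<Rightarrow> nat \<times> nat \<Rightarrow> complex" where
  "da_coeff f = power_coeff (da_eval f)"


subsection \<open>Uniqueness of power series coefficients\<close>

lemma powser_all_zero:
  fixes c :: "nat \<Rightarrow> complex"
  assumes r: "r > 0" and s: "\<And>x. norm x < r \<Longrightarrow> (\<lambda>n. c n * x ^ n) sums 0"
  shows "c n = 0"
proof (induction n rule: less_induct)
  case (less n)
  have "(\<lambda>m. c (m + n) * x ^ m) sums 0" if "x \<noteq> 0" "norm x < r" for x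
  proof -
    have "(\<lambda>m. c (m + n) * x ^ (m + n)) sums (0 - (\<Sum>i<n. c i * x ^ i))"
      using s[OF that(2)] sums_iff_shift'[of "\<lambda>m. c m * x ^ m" n 0] by blast
    hence "(\<lambda>m. c (m + n) * x ^ (m + n)) sums 0"
      using less.IH by simp
    hence "(\<lambda>m. inverse (x ^ n) * (c (m + n) * x ^ (m + n))) sums (inverse (x ^ n) * 0)"
      by (rule sums_mult)
    moreover have "inverse (x ^ n) * (c (m + n) * x ^ (m + n)) = c (m + n) * x ^ m" for m
      using that(1) by (simp add: power_add)
    ultimately show ?thesis by simp
  qed
  hence "((\<lambda>_. 0) \<longlongrightarrow> c (0 + n)) (at (0::complex))"
    using powser_limit_0_strong[of r "\<lambda>m. c (m + n)" "\<lambda>_. 0"] r by blast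
  thus ?case by (simp add: tendsto_const_iff)
qed

lemma mem_ball_pair: "(z1, z2) \<in> ball (0 :: complex \<times> complex) 1 \<longleftrightarrow> (cmod z1)\<^sup>2 + (cmod z2)\<^sup>2 < 1"
  by (simp add: norm_Pair)

lemma has_power_expansion_zero:
  assumes "has_power_expansion (\<lambda>_. 0) c"
  shows "c = (\<lambda>_. 0)"
proof -
  have main: "((\<lambda>(m, n). c (m, n) * (z1 ^ m * z2 ^ n)) has_sum 0) (UNIV \<times> UNIV)"
    if "cmod z1 < 1/2" "cmod z2 < 1/2" for z1 z2
  proof -
    have "(cmod z1)\<^sup>2 \<le> (1/2)\<^sup>2" "(cmod z2)\<^sup>2 \<le> (1/2)\<^sup>2"
      using that by (auto intro!: power_mono)
    hence "(z1, z2) \<in> ball 0 1"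
      unfolding mem_ball_pair by (simp add: power2_eq_square)
    from bspec[OF assms[unfolded has_power_expansion_def] this] show ?thesis
      by (simp add: mono_eval_def case_prod_unfold)
  qed
  have inner: "(\<lambda>n. c (m, n) * z2 ^ n) summable_on UNIV \<and> infsum (\<lambda>n. c (m, n) * z2 ^ n) UNIV = 0"
    if z2: "cmod z2 < 1/2" for z2 m
  proof -
    have summ: "(\<lambda>n. c (m, n) * (z1 ^ m * z2 ^ n)) summable_on UNIV" if "cmod z1 < 1/2" for z1 m
      using summable_on_SigmaD1[OF has_sum_imp_summable[OF main[OF that z2]], of m] by simp
    have summ': "(\<lambda>n. c (m, n) * z2 ^ n) summable_on UNIV" for m
    proof -
      have "(\<lambda>n. (4 ^ m) * (c (m, n) * ((1/4) ^ m * z2 ^ n))) summable_on UNIV"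
        by (intro summable_on_cmult_right summ) auto
      thus ?thesis by (simp add: power_divide)
    qed
    define b where "b m = infsum (\<lambda>n. c (m, n) * z2 ^ n) UNIV" for m
    have "(\<lambda>m. b m * z1 ^ m) sums 0" if z1: "cmod z1 < 1/2" for z1
    proof -
      have "((\<lambda>n. c (m, n) * (z1 ^ m * z2 ^ n)) has_sum (b m * z1 ^ m)) UNIV" for m
      proof -
        have "((\<lambda>n. (c (m, n) * z2 ^ n) * z1 ^ m) has_sum (b m * z1 ^ m)) UNIV"
          unfolding b_def by (intro has_sum_cmult_left has_sum_infsum summ')
        thus ?thesis by (simp add: mult_ac)
      qed
      hence "((\<lambda>m. b m * z1 ^ m) has_sum 0) UNIV"
        using has_sum_SigmaD[OF main[OF z1 z2], of "\<lambda>m. b m * z1 ^ m"] by simp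
      thus ?thesis by (rule has_sum_imp_sums)
    qed
    hence "b m = 0" by (intro powser_all_zero[of "1/2" b]) auto
    thus ?thesis using summ' by (simp add: b_def)
  qed
  have "c (m, n) = 0" for m n
  proof (rule powser_all_zero[of "1/2" "\<lambda>n. c (m, n)"])
    fix x :: complex assume "norm x < 1/2"
    from inner[OF this, of m] show "(\<lambda>n. c (m, n) * x ^ n) sums 0"
      by (metis has_sum_imp_sums has_sum_infsum)
  qed auto
  thus ?thesis by (auto simp: fun_eq_iff)
qed

lemma has_power_expansion_add:
  "has_power_expansion f a \<Longrightarrow> has_power_expansion g b \<Longrightarrow>
   has_power_expansion (\<lambda>z. f z + g z) (\<lambda>i. a i + b i)"
  unfolding has_power_expansion_def by (auto simp: distrib_right intro!: has_sum_add)

lemma has_power_expansion_cmult: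
  "has_power_expansion f a \<Longrightarrow> has_power_expansion (\<lambda>z. c * f z) (\<lambda>i. c * a i)"
  unfolding has_power_expansion_def by (auto simp: mult.assoc intro!: has_sum_cmult_right)

lemma has_power_expansion_unique:
  assumes "has_power_expansion f a" "has_power_expansion f b"
  shows "a = b"
proof -
  have "has_power_expansion (\<lambda>z. f z + (-1) * f z) (\<lambda>i. a i + (-1) * b i)"
    by (intro has_power_expansion_add has_power_expansion_cmult assms)
  hence "(\<lambda>i. a i + (-1) * b i) = (\<lambda>_. 0)"
    by (intro has_power_expansion_zero) simp
  thus ?thesis by (auto simp: fun_eq_iff)
qed

lemma power_coeff_eq: "has_power_expansion f a \<Longrightarrow> power_coeff f = a"
  unfolding power_coeff_def by (rule the_equality) (auto intro: has_power_expansion_unique)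

lemma da_expansion: "has_power_expansion (da_eval f) (da_coeff f)"
  and da_coeff_l2: "weighted_l2 (da_coeff f)"
proof -
  from da_eval[of f] obtain a where a: "has_power_expansion (da_eval f) a" "weighted_l2 a"
    unfolding mem_Collect_eq by blast
  moreover from a have "da_coeff f = a" by (simp add: da_coeff_def power_coeff_eq)
  ultimately show "has_power_expansion (da_eval f) (da_coeff f)" "weighted_l2 (da_coeff f)" by auto
qed

lemma da_eval_outside: "z \<notin> ball 0 1 \<Longrightarrow> da_eval f z = 0"
  using da_eval[of f] unfolding mem_Collect_eq by blast

lemma da_coeff_eqI: "has_power_expansion (da_eval f) a \<Longrightarrow> da_coeff f = a"
  by (simp add: da_coeff_def power_coeff_eq)

lemma da_eqI: "da_coeff f = da_coeff g \<Longrightarrow> f = g"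
proof -
  assume eq: "da_coeff f = da_coeff g"
  have "da_eval f z = da_eval g z" for z
  proof (cases "z \<in> ball 0 1")
    case True
    from bspec[OF da_expansion[of f, unfolded has_power_expansion_def] True]
      bspec[OF da_expansion[of g, unfolded has_power_expansion_def] True]
    show ?thesis unfolding eq by (rule has_sum_unique)
  qed (simp add: da_eval_outside)
  hence "da_eval f = da_eval g" by (rule ext)
  thus "f = g" by (simp only: da_eval_inject)
qed


subsection \<open>Square-summable coefficient families\<close>

lemma mono_weight_pos: "mono_weight i > 0"
  by (cases i) (auto simp: mono_weight_def zero_less_binomial_iff)

lemma mono_weight_nonneg [simp]: "mono_weight i \<ge> 0"
  using mono_weight_pos[of i] by simp

lemma mono_weight_nz [simp]: "mono_weight i \<noteq> 0"
  using mono_weight_pos[of i] by simp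

lemma weighted_l2_add:
  assumes "weighted_l2 a" "weighted_l2 b"
  shows "weighted_l2 (\<lambda>i. a i + b i)"
  unfolding weighted_l2_def
proof (rule summable_on_comparison_test)
  show "(\<lambda>i. 2 * ((cmod (a i))\<^sup>2 / mono_weight i) + 2 * ((cmod (b i))\<^sup>2 / mono_weight i)) summable_on UNIV"
    using assms unfolding weighted_l2_def
    by (intro summable_on_add summable_on_cmult_right)
  fix i
  have "(cmod (a i + b i))\<^sup>2 \<le> (cmod (a i) + cmod (b i))\<^sup>2"
    by (intro power_mono norm_triangle_ineq) auto
  also have "\<dots> \<le> 2 * (cmod (a i))\<^sup>2 + 2 * (cmod (b i))\<^sup>2"
    using sum_squares_bound[of "cmod (a i)" "cmod (b i)"] by (simp add: power2_sum)
  finally show "(cmod (a i + b i))\<^sup>2 / mono_weight i \<le>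
      2 * ((cmod (a i))\<^sup>2 / mono_weight i) + 2 * ((cmod (b i))\<^sup>2 / mono_weight i)"
    by (simp add: divide_simps mono_weight_pos)
qed auto

lemma weighted_l2_cmult: "weighted_l2 a \<Longrightarrow> weighted_l2 (\<lambda>i. c * a i)"
  unfolding weighted_l2_def
  by (drule summable_on_cmult_right[where c = "(cmod c)\<^sup>2"])
     (simp add: norm_mult power_mult_distrib)

lemma l2_product_summable:
  assumes "weighted_l2 a" "weighted_l2 b"
  shows "(\<lambda>i. a i * cnj (b i) / of_real (mono_weight i)) summable_on UNIV"
proof (rule abs_summable_summable, rule summable_on_comparison_test)
  show "(\<lambda>i. (cmod (a i))\<^sup>2 / mono_weight i + (cmod (b i))\<^sup>2 / mono_weight i) summable_on UNIV"
    using assms unfolding weighted_l2_def by (intro summable_on_add)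
  fix i
  have "2 * (cmod (a i) * cmod (b i)) \<le> (cmod (a i))\<^sup>2 + (cmod (b i))\<^sup>2"
    using sum_squares_bound[of "cmod (a i)" "cmod (b i)"] by (simp add: mult.assoc)
  moreover have "cmod (a i) * cmod (b i) \<ge> 0" by simp
  ultimately have "cmod (a i) * cmod (b i) \<le> (cmod (a i))\<^sup>2 + (cmod (b i))\<^sup>2" by linarith
  thus "norm (a i * cnj (b i) / of_real (mono_weight i)) \<le>
      (cmod (a i))\<^sup>2 / mono_weight i + (cmod (b i))\<^sup>2 / mono_weight i"
    by (simp add: norm_mult norm_divide add_divide_distrib[symmetric] divide_right_mono)
qed auto

lemma kernel_summable:
  assumes "z \<in> ball 0 1"
  shows "(\<lambda>i. mono_weight i * (cmod (mono_eval i z))\<^sup>2) summable_on UNIV"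
proof -
  obtain z1 z2 where z: "z = (z1, z2)" by force
  define x y where "x = (cmod z1)\<^sup>2" and "y = (cmod z2)\<^sup>2"
  have xy: "x \<ge> 0" "y \<ge> 0" "x + y < 1"
    using assms unfolding z mem_ball_pair by (auto simp: x_def y_def)
  have sq: "(r ^ m)\<^sup>2 = (r\<^sup>2) ^ m" for r :: real and m
    by (metis power_mult mult.commute)
  have t: "mono_weight i * (cmod (mono_eval i z))\<^sup>2 =
      (case i of (m, n) \<Rightarrow> real ((m + n) choose m) * x ^ m * y ^ n)" for i
    by (cases i) (simp add: mono_weight_def mono_eval_def z norm_mult norm_power x_def y_def
        power_mult_distrib sq)
  define g :: "nat \<times> nat \<Rightarrow> real" where "g = (\<lambda>(m, n). real ((m + n) choose m) * x ^ m * y ^ n)"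
  have gnn: "g i \<ge> 0" for i using xy by (cases i) (simp add: g_def)
  have bound: "sum g F \<le> 1 / (1 - (x + y))" if F: "finite F" for F
  proof -
    define N where "N = Max (insert 0 ((\<lambda>(m, n). m + n) ` F))"
    have sub: "F \<subseteq> (\<lambda>(d, m). (m, d - m)) ` (SIGMA d:{..N}. {..d})"
    proof
      fix i assume i: "i \<in> F"
      obtain m n where mn: "i = (m, n)" by force
      have "m + n \<le> N" unfolding N_def using F i mn by (intro Max_ge) force+
      thus "i \<in> (\<lambda>(d, m). (m, d - m)) ` (SIGMA d:{..N}. {..d})"
        by (intro image_eqI[of _ _ "(m + n, m)"]) (auto simp: mn)
    qed
    have inj: "inj_on (\<lambda>(d, m). (m, d - m)) (SIGMA d:{..N}. {..d})"
      by (auto simp: inj_on_def)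
    have "sum g F \<le> sum g ((\<lambda>(d, m). (m, d - m)) ` (SIGMA d:{..N}. {..d}))"
      by (intro sum_mono2 sub gnn) auto
    also have "\<dots> = (\<Sum>(d, m)\<in>(SIGMA d:{..N}. {..d}). g (m, d - m))"
      by (subst sum.reindex[OF inj]) (simp add: case_prod_unfold o_def)
    also have "\<dots> = (\<Sum>d\<le>N. \<Sum>m\<le>d. g (m, d - m))"
      by (subst sum.Sigma) auto
    also have "\<dots> = (\<Sum>d\<le>N. (x + y) ^ d)"
    proof (rule sum.cong[OF refl])
      fix d
      show "(\<Sum>m\<le>d. g (m, d - m)) = (x + y) ^ d"
        unfolding binomial_ring[of x y d] by (intro sum.cong) (auto simp: g_def)
    qed
    also have "\<dots> \<le> (\<Sum>d. (x + y) ^ d)"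
      using xy by (intro sum_le_suminf summable_geometric) auto
    also have "\<dots> = 1 / (1 - (x + y))"
      using xy by (intro suminf_geometric) auto
    finally show ?thesis .
  qed
  have "g summable_on UNIV"
  proof (rule nonneg_bdd_above_summable_on)
    show "bdd_above (sum g ` {F. F \<subseteq> UNIV \<and> finite F})"
      by (rule bdd_aboveI[of _ "1 / (1 - (x + y))"]) (auto intro: bound)
  qed (rule gnn)
  thus ?thesis unfolding t by (simp add: g_def case_prod_unfold)
qed

lemma l2_power_series_summable:
  assumes "weighted_l2 a" "z \<in> ball 0 1"
  shows "(\<lambda>i. a i * mono_eval i z) summable_on UNIV"
proof (rule abs_summable_summable, rule summable_on_comparison_test)
  show "(\<lambda>i. (cmod (a i))\<^sup>2 / mono_weight i + mono_weight i * (cmod (mono_eval i z))\<^sup>2) summable_on UNIV"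
    using assms kernel_summable unfolding weighted_l2_def by (intro summable_on_add) auto
  fix i
  define w where "w = sqrt (mono_weight i)"
  have w: "w > 0" "mono_weight i = w\<^sup>2"
    using mono_weight_pos[of i] by (auto simp: w_def)
  have "2 * ((cmod (a i) / w) * (w * cmod (mono_eval i z))) \<le>
      (cmod (a i) / w)\<^sup>2 + (w * cmod (mono_eval i z))\<^sup>2"
    using sum_squares_bound[of "cmod (a i) / w" "w * cmod (mono_eval i z)"] by (simp only: mult.assoc)
  moreover have "(cmod (a i) / w) * (w * cmod (mono_eval i z)) = norm (a i * mono_eval i z)"
    using w by (simp add: norm_mult)
  moreover have "norm (a i * mono_eval i z) \<ge> 0" by simp
  ultimately have "norm (a i * mono_eval i z) \<le> (cmod (a i) / w)\<^sup>2 + (w * cmod (mono_eval i z))\<^sup>2"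
    by linarith
  thus "norm (a i * mono_eval i z) \<le>
      (cmod (a i))\<^sup>2 / mono_weight i + mono_weight i * (cmod (mono_eval i z))\<^sup>2"
    by (simp add: w power_divide power_mult_distrib)
qed auto

lemma da_coeff_surj:
  assumes "weighted_l2 a"
  obtains f where "da_coeff f = a"
proof -
  define F where "F z = (if z \<in> ball 0 1 then infsum (\<lambda>i. a i * mono_eval i z) UNIV else 0)" for z
  have F: "has_power_expansion F a"
    using l2_power_series_summable[OF assms] by (auto simp: has_power_expansion_def F_def)
  hence "da_eval (Abs_da F) = F"
    using assms by (intro Abs_da_inverse) (auto simp: F_def)
  thus ?thesis using F that[of "Abs_da F"] by (metis da_coeff_eqI)
qed


subsection \<open>Hilbert space structure\<close>

text \<open>
  The inner product is the unique one (linear in its first argument) for which distinct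
  monomials are orthogonal and \<open>\<parallel>z\<^sub>1\<^sup>m z\<^sub>2\<^sup>n\<parallel>\<^sup>2 = 1 / (m + n choose m)\<close>.
\<close>

definition da_inner :: "drury_arveson \<Rightarrow> drury_arveson \<Rightarrow> complex" where
  "da_inner f g = (\<Sum>\<^sub>\<infinity>i. da_coeff f i * cnj (da_coeff g i) / of_real (mono_weight i))"

lift_definition da_scale :: "complex \<Rightarrow> drury_arveson \<Rightarrow> drury_arveson" is "\<lambda>c f z. c * f z"
  by (auto 4 3 simp del: split_paired_All intro: has_power_expansion_cmult weighted_l2_cmult)

instantiation drury_arveson :: real_inner
begin

lift_definition zero_drury_arveson :: drury_arveson is "\<lambda>_. 0"
  by (auto simp: has_power_expansion_def weighted_l2_def intro!: exI[of _ "\<lambda>_. 0"])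

lift_definition plus_drury_arveson :: "drury_arveson \<Rightarrow> drury_arveson \<Rightarrow> drury_arveson"
  is "\<lambda>f g z. f z + g z"
  by (auto 4 3 simp del: split_paired_All intro: has_power_expansion_add weighted_l2_add)

definition "- f = da_scale (- 1) f"
definition "f - g = f + - (g :: drury_arveson)"
definition "r *\<^sub>R f = da_scale (of_real r) f"
definition "inner f g = Re (da_inner f g)"
definition "norm f = sqrt (inner f (f :: drury_arveson))"
definition "sgn f = da_scale (of_real (inverse (norm f))) f"
definition "dist f g = norm (f - g :: drury_arveson)"
definition "(uniformity :: (drury_arveson \<times> drury_arveson) filter) =
  (INF e\<in>{0<..}. principal {(f, g). dist f g < e})"
definition "open (U :: drury_arveson set) \<longleftrightarrow>
  (\<forall>x\<in>U. eventually (\<lambda>(x', y). x' = x \<longrightarrow> y \<in> U) uniformity)"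

lemma da_coeff_zero: "da_coeff 0 = (\<lambda>_. 0)"
  by (rule da_coeff_eqI) (simp add: zero_drury_arveson.rep_eq has_power_expansion_def)

lemma da_coeff_add: "da_coeff (f + g) = (\<lambda>i. da_coeff f i + da_coeff g i)"
  by (rule da_coeff_eqI)
     (simp add: plus_drury_arveson.rep_eq has_power_expansion_add da_expansion)

lemma da_coeff_scale: "da_coeff (da_scale c f) = (\<lambda>i. c * da_coeff f i)"
  by (rule da_coeff_eqI) (simp add: da_scale.rep_eq has_power_expansion_cmult da_expansion)

lemma da_inner_summable:
  "(\<lambda>i. da_coeff f i * cnj (da_coeff g i) / of_real (mono_weight i)) summable_on UNIV"
  by (intro l2_product_summable da_coeff_l2)

lemma da_inner_add_left: "da_inner (f + g) h = da_inner f h + da_inner g h"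
  unfolding da_inner_def
  by (subst infsum_add[symmetric, OF da_inner_summable da_inner_summable])
     (simp add: da_coeff_add add_divide_distrib distrib_right)

lemma da_inner_scale_left: "da_inner (da_scale c f) g = c * da_inner f g"
  unfolding da_inner_def
  by (subst infsum_cmult_right[symmetric, OF da_inner_summable])
     (simp add: da_coeff_scale mult.assoc)

lemma da_inner_commute: "da_inner f g = cnj (da_inner g f)"
  unfolding da_inner_def infsum_cnj[symmetric] by (simp add: mult.commute)

lemma da_inner_self:
  "da_inner f f = of_real (\<Sum>\<^sub>\<infinity>i. (cmod (da_coeff f i))\<^sup>2 / mono_weight i)"
proof -
  have "((\<lambda>i. (cmod (da_coeff f i))\<^sup>2 / mono_weight i) has_sum
      (\<Sum>\<^sub>\<infinity>i. (cmod (da_coeff f i))\<^sup>2 / mono_weight i)) UNIV"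
    using da_coeff_l2[of f] unfolding weighted_l2_def by (rule has_sum_infsum)
  from has_sum_of_real[OF this, where ?'a = complex] show ?thesis
    unfolding da_inner_def of_real_divide complex_norm_square by (rule infsumI)
qed

instance
proof
  fix f g h :: drury_arveson and r s :: real
  show "f + g + h = f + (g + h)" "f + g = g + f" "0 + f = f"
    by (rule da_eqI; simp add: da_coeff_add da_coeff_zero algebra_simps)+
  show "- f + f = 0"
    by (rule da_eqI) (simp add: da_coeff_add da_coeff_zero da_coeff_scale uminus_drury_arveson_def)
  show "f - g = f + - g" by (rule minus_drury_arveson_def)
  show "r *\<^sub>R (f + g) = r *\<^sub>R f + r *\<^sub>R g" "(r + s) *\<^sub>R f = r *\<^sub>R f + s *\<^sub>R f"
    "r *\<^sub>R s *\<^sub>R f = (r * s) *\<^sub>R f" "1 *\<^sub>R f = f"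
    unfolding scaleR_drury_arveson_def
    by (rule da_eqI; simp add: da_coeff_add da_coeff_scale algebra_simps)+
  show "dist f g = norm (f - g)" by (rule dist_drury_arveson_def)
  show "sgn f = inverse (norm f) *\<^sub>R f" by (simp add: sgn_drury_arveson_def scaleR_drury_arveson_def)
  show "uniformity = (INF e\<in>{0<..}. principal {(f :: drury_arveson, g). dist f g < e})"
    by (rule uniformity_drury_arveson_def)
  show "open U \<longleftrightarrow> (\<forall>x\<in>U. eventually (\<lambda>(x', y). x' = x \<longrightarrow> y \<in> U) uniformity)"
    for U :: "drury_arveson set" by (rule open_drury_arveson_def)
  show "inner f g = inner g f"
    unfolding inner_drury_arveson_def by (subst da_inner_commute) simp
  show "inner (f + g) h = inner f h + inner g h" "inner (r *\<^sub>R f) g = r * inner f g"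
    by (simp_all add: inner_drury_arveson_def da_inner_add_left da_inner_scale_left
        scaleR_drury_arveson_def)
  show "0 \<le> inner f f"
    by (simp add: inner_drury_arveson_def da_inner_self infsum_nonneg)
  show "norm f = sqrt (inner f f)" by (rule norm_drury_arveson_def)
  show "inner f f = 0 \<longleftrightarrow> f = 0"
  proof
    assume "inner f f = 0"
    hence 0: "(\<Sum>\<^sub>\<infinity>i. (cmod (da_coeff f i))\<^sup>2 / mono_weight i) \<le> 0"
      by (simp add: inner_drury_arveson_def da_inner_self)
    have "(cmod (da_coeff f i))\<^sup>2 / mono_weight i = 0" for i
      by (rule nonneg_infsum_le_0D[OF 0])
         (use da_coeff_l2[of f] in \<open>auto simp: weighted_l2_def\<close>)
    thus "f = 0" by (intro da_eqI) (simp add: da_coeff_zero fun_eq_iff)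
  qed (simp add: inner_drury_arveson_def da_inner_def da_coeff_zero)
qed

end

lemma da_coeff_uminus: "da_coeff (- f) = (\<lambda>i. - da_coeff f i)"
  by (simp add: uminus_drury_arveson_def da_coeff_scale)

lemma da_coeff_diff: "da_coeff (f - g) = (\<lambda>i. da_coeff f i - da_coeff g i)"
  unfolding minus_drury_arveson_def da_coeff_add da_coeff_uminus by simp

lemma norm_da_sq: "(norm f)\<^sup>2 = (\<Sum>\<^sub>\<infinity>i. (cmod (da_coeff f i))\<^sup>2 / mono_weight i)"
  by (simp add: norm_drury_arveson_def inner_drury_arveson_def da_inner_self infsum_nonneg)

lemma finite_sum_le_norm_da:
  "finite F \<Longrightarrow> (\<Sum>i\<in>F. (cmod (da_coeff f i))\<^sup>2 / mono_weight i) \<le> (norm f)\<^sup>2"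
  unfolding norm_da_sq using da_coeff_l2[of f]
  by (intro finite_sum_le_infsum) (auto simp: weighted_l2_def)

instance drury_arveson :: complete_space
proof
  fix X :: "nat \<Rightarrow> drury_arveson"
  assume X: "Cauchy X"
  have cau: "Cauchy (\<lambda>n. da_coeff (X n) i)" for i
  proof (rule metric_CauchyI)
    fix e :: real assume e: "e > 0"
    hence "e / sqrt (mono_weight i) > 0" using mono_weight_pos by simp
    from metric_CauchyD[OF X this] obtain M where
      M: "\<And>m n. m \<ge> M \<Longrightarrow> n \<ge> M \<Longrightarrow> dist (X m) (X n) < e / sqrt (mono_weight i)" by blast
    have "dist (da_coeff (X m) i) (da_coeff (X n) i) < e" if "m \<ge> M" "n \<ge> M" for m n
    proof -
      have "(cmod (da_coeff (X m - X n) i))\<^sup>2 / mono_weight i \<le> (norm (X m - X n))\<^sup>2"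
        using finite_sum_le_norm_da[of "{i}" "X m - X n"] by simp
      also have "\<dots> < (e / sqrt (mono_weight i))\<^sup>2"
        using M[OF that] by (intro power_strict_mono) (auto simp: dist_norm)
      finally have "(cmod (da_coeff (X m - X n) i))\<^sup>2 < e\<^sup>2"
        using mono_weight_pos[of i] by (simp add: power_divide divide_strict_right_mono field_simps)
      hence "cmod (da_coeff (X m - X n) i) < e"
        using e power_less_imp_less_base[of _ 2 e] by auto
      thus ?thesis by (simp add: da_coeff_diff dist_norm)
    qed
    thus "\<exists>M. \<forall>m\<ge>M. \<forall>n\<ge>M. dist (da_coeff (X m) i) (da_coeff (X n) i) < e" by blast
  qed
  define a where "a i = lim (\<lambda>n. da_coeff (X n) i)" for i
  have lim: "(\<lambda>n. da_coeff (X n) i) \<longlonglongrightarrow> a i" for i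
    unfolding a_def using cau[of i] by (simp add: Cauchy_convergent convergent_LIMSEQ_iff[symmetric])
  have key: "\<exists>M. \<forall>n\<ge>M. \<forall>F. finite F \<longrightarrow> (\<Sum>i\<in>F. (cmod (da_coeff (X n) i - a i))\<^sup>2 / mono_weight i) \<le> e\<^sup>2"
    if "e > 0" for e
  proof -
    from metric_CauchyD[OF X that] obtain M where
      M: "\<And>m n. m \<ge> M \<Longrightarrow> n \<ge> M \<Longrightarrow> dist (X m) (X n) < e" by blast
    have "(\<Sum>i\<in>F. (cmod (da_coeff (X n) i - a i))\<^sup>2 / mono_weight i) \<le> e\<^sup>2"
      if n: "n \<ge> M" and F: "finite F" for n F
    proof (rule LIMSEQ_le_const2)
      show "(\<lambda>m. \<Sum>i\<in>F. (cmod (da_coeff (X n) i - da_coeff (X m) i))\<^sup>2 / mono_weight i) \<longlonglongrightarrow>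
        (\<Sum>i\<in>F. (cmod (da_coeff (X n) i - a i))\<^sup>2 / mono_weight i)"
        by (intro tendsto_intros lim) simp_all
      have "(\<Sum>i\<in>F. (cmod (da_coeff (X n) i - da_coeff (X m) i))\<^sup>2 / mono_weight i) \<le> e\<^sup>2"
        if "m \<ge> M" for m
      proof -
        have "(\<Sum>i\<in>F. (cmod (da_coeff (X n) i - da_coeff (X m) i))\<^sup>2 / mono_weight i)
            \<le> (norm (X n - X m))\<^sup>2"
          using finite_sum_le_norm_da[OF F, of "X n - X m"] by (simp add: da_coeff_diff)
        also have "\<dots> \<le> e\<^sup>2"
          using M[OF n that] by (intro power_mono) (auto simp: dist_norm)
        finally show ?thesis .
      qed
      thus "\<exists>N. \<forall>m\<ge>N. (\<Sum>i\<in>F. (cmod (da_coeff (X n) i - da_coeff (X m) i))\<^sup>2 / mono_weight i) \<le> e\<^sup>2"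
        by blast
    qed
    thus ?thesis by blast
  qed
  have l2d: "weighted_l2 (\<lambda>i. da_coeff (X n) i - a i) \<and>
      (\<Sum>\<^sub>\<infinity>i. (cmod (da_coeff (X n) i - a i))\<^sup>2 / mono_weight i) \<le> e\<^sup>2"
    if "\<forall>F. finite F \<longrightarrow> (\<Sum>i\<in>F. (cmod (da_coeff (X n) i - a i))\<^sup>2 / mono_weight i) \<le> e\<^sup>2" for n e
  proof -
    have "weighted_l2 (\<lambda>i. da_coeff (X n) i - a i)"
      unfolding weighted_l2_def
    proof (rule nonneg_bdd_above_summable_on)
      show "bdd_above (sum (\<lambda>i. (cmod (da_coeff (X n) i - a i))\<^sup>2 / mono_weight i) `
          {F. F \<subseteq> UNIV \<and> finite F})"
        using that by (intro bdd_aboveI[of _ "e\<^sup>2"]) auto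
    qed auto
    thus ?thesis using that
      by (auto simp: weighted_l2_def intro!: infsum_le_finite_sums)
  qed
  have "weighted_l2 a"
  proof -
    obtain n where "\<forall>F. finite F \<longrightarrow>
        (\<Sum>i\<in>F. (cmod (da_coeff (X n) i - a i))\<^sup>2 / mono_weight i) \<le> 1\<^sup>2"
      using key[of 1] by auto
    hence "weighted_l2 (\<lambda>i. da_coeff (X n) i - a i)" using l2d by blast
    from weighted_l2_add[OF da_coeff_l2[of "X n"] weighted_l2_cmult[OF this, of "-1"]]
    show ?thesis by simp
  qed
  then obtain f where f: "da_coeff f = a" by (rule da_coeff_surj)
  have "X \<longlonglongrightarrow> f"
  proof (rule metric_LIMSEQ_I)
    fix e :: real assume e: "e > 0"
    then obtain M where M: "\<forall>n\<ge>M. \<forall>F. finite F \<longrightarrow>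
        (\<Sum>i\<in>F. (cmod (da_coeff (X n) i - a i))\<^sup>2 / mono_weight i) \<le> (e/2)\<^sup>2"
      using key[of "e/2"] by auto
    have "dist (X n) f < e" if "n \<ge> M" for n
    proof -
      have "(norm (X n - f))\<^sup>2 \<le> (e/2)\<^sup>2"
        using l2d[of n "e/2"] M that by (simp add: norm_da_sq da_coeff_diff f)
      hence "norm (X n - f) \<le> e/2"
        using e power2_le_imp_le[of "norm (X n - f)" "e/2"] by simp
      thus ?thesis using e by (simp add: dist_norm)
    qed
    thus "\<exists>M. \<forall>n\<ge>M. dist (X n) f < e" by blast
  qed
  thus "convergent X" by (auto simp: convergent_def)
qed

instance drury_arveson :: banach ..


subsection \<open>Polynomials as elements of the space\<close>

text \<open>
  \<open>\<complex>[z\<^sub>1, z\<^sub>2]\<close> is the iterated polynomial ring \<^typ>\<open>complex poly poly\<close> with \<open>z\<^sub>1\<close> the inner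
  and \<open>z\<^sub>2\<close> the outer variable.
\<close>

definition Z1 :: "complex poly poly" where "Z1 = [:[:0, 1:]:]"
definition Z2 :: "complex poly poly" where "Z2 = [:0, 1:]"
definition const2 :: "complex \<Rightarrow> complex poly poly" where "const2 c = [:[:c:]:]"

definition poly2 :: "complex poly poly \<Rightarrow> complex \<times> complex \<Rightarrow> complex" where
  "poly2 q = (\<lambda>(z1, z2). poly (poly q [:z2:]) z1)"

definition principal_ideal :: "complex poly poly \<Rightarrow> complex poly poly set" where
  "principal_ideal p = {q * p | q. True}"

lemma poly2_simps [simp]:
  "poly2 Z1 (z1, z2) = z1" "poly2 Z2 (z1, z2) = z2" "poly2 (const2 c) z = c"
  "poly2 (p + q) z = poly2 p z + poly2 q z" "poly2 (p - q) z = poly2 p z - poly2 q z"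
  "poly2 (p * q) z = poly2 p z * poly2 q z" "poly2 (p ^ n) z = poly2 p z ^ n"
  by (simp_all add: poly2_def Z1_def Z2_def const2_def case_prod_beta poly_power)

definition coeff2 :: "complex poly poly \<Rightarrow> nat \<times> nat \<Rightarrow> complex" where
  "coeff2 q = (\<lambda>(m, n). coeff (coeff q n) m)"

lemma poly_bounded_sum:
  fixes p :: "complex poly"
  shows "degree p \<le> M \<Longrightarrow> poly p x = (\<Sum>i\<le>M. coeff p i * x ^ i)"
  unfolding poly_altdef[of p x] by (rule sum.mono_neutral_left) (auto simp: coeff_eq_0)

lemma poly2_expansion:
  "\<exists>F. finite F \<and> (\<forall>i. i \<notin> F \<longrightarrow> coeff2 q i = 0) \<and>
     (\<forall>z. poly2 q z = (\<Sum>i\<in>F. coeff2 q i * mono_eval i z))"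
proof -
  define N where "N = degree q"
  define M where "M = Max ((\<lambda>n. degree (coeff q n)) ` {..N})"
  have M: "degree (coeff q n) \<le> M" if "n \<le> N" for n
    unfolding M_def using that by (intro Max_ge) auto
  show ?thesis
  proof (intro exI[of _ "{..M} \<times> {..N}"] conjI allI impI)
    fix i :: "nat \<times> nat" assume i: "i \<notin> {..M} \<times> {..N}"
    obtain m n where mn: "i = (m, n)" by force
    have "coeff (coeff q n) m = 0"
    proof (cases "n \<le> N")
      case True
      hence "m > degree (coeff q n)" using i mn M[of n] by auto
      thus ?thesis by (rule coeff_eq_0)
    next
      case False
      thus ?thesis by (simp add: N_def coeff_eq_0)
    qed
    thus "coeff2 q i = 0" by (simp add: coeff2_def mn)
  next
    fix z :: "complex \<times> complex"
    obtain z1 z2 where z: "z = (z1, z2)" by force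
    have "poly2 q z = (\<Sum>n\<le>N. poly (coeff q n) z1 * z2 ^ n)"
      by (simp add: poly2_def z poly_altdef[of q] poly_sum poly_power N_def)
    also have "\<dots> = (\<Sum>n\<le>N. \<Sum>m\<le>M. coeff (coeff q n) m * (z1 ^ m * z2 ^ n))"
      by (intro sum.cong refl) (simp add: poly_bounded_sum[OF M] sum_distrib_right mult.assoc)
    also have "\<dots> = (\<Sum>m\<le>M. \<Sum>n\<le>N. coeff (coeff q n) m * (z1 ^ m * z2 ^ n))"
      by (rule sum.swap)
    also have "\<dots> = (\<Sum>i\<in>{..M} \<times> {..N}. coeff2 q i * mono_eval i z)"
      by (subst sum.cartesian_product)
         (auto simp: coeff2_def mono_eval_def z intro!: sum.cong)
    finally show "poly2 q z = (\<Sum>i\<in>{..M} \<times> {..N}. coeff2 q i * mono_eval i z)" .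
  qed auto
qed

lemma poly2_has_power_expansion:
  "has_power_expansion (\<lambda>z. if z \<in> ball 0 1 then poly2 q z else 0) (coeff2 q)"
  and weighted_l2_coeff2: "weighted_l2 (coeff2 q)"
proof -
  obtain F where F: "finite F" "\<And>i. i \<notin> F \<Longrightarrow> coeff2 q i = 0"
    "\<And>z. poly2 q z = (\<Sum>i\<in>F. coeff2 q i * mono_eval i z)" using poly2_expansion[of q] by blast
  show "has_power_expansion (\<lambda>z. if z \<in> ball 0 1 then poly2 q z else 0) (coeff2 q)"
    unfolding has_power_expansion_def
    by (intro ballI has_sum_finite_neutralI[of F]) (auto simp: F)
  have "{i. coeff2 q i \<noteq> 0} \<subseteq> F" using F(2) by auto
  hence fin: "finite {i. coeff2 q i \<noteq> 0}" using F(1) finite_subset by blast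
  show "weighted_l2 (coeff2 q)"
    unfolding weighted_l2_def
    by (intro finite_nonzero_values_imp_summable_on) (simp add: fin)
qed

definition da_poly :: "complex poly poly \<Rightarrow> drury_arveson" where
  "da_poly q = Abs_da (\<lambda>z. if z \<in> ball 0 1 then poly2 q z else 0)"

lemma da_eval_poly: "da_eval (da_poly q) = (\<lambda>z. if z \<in> ball 0 1 then poly2 q z else 0)"
  unfolding da_poly_def
  by (intro Abs_da_inverse CollectI conjI allI impI exI[of _ "coeff2 q"]
      poly2_has_power_expansion weighted_l2_coeff2) (simp only: if_False)

lemma da_coeff_poly: "da_coeff (da_poly q) = coeff2 q"
  by (rule da_coeff_eqI) (simp only: da_eval_poly poly2_has_power_expansion)

lemma coeff2_monomial: "coeff2 (Z1 ^ m * Z2 ^ n) i = (if i = (m, n) then 1 else 0)"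
proof -
  have Z1: "Z1 ^ m = [:monom 1 m:]"
  proof (induction m)
    case 0
    show ?case by (simp only: monom_0 power_0 pCons_one)
  next
    case (Suc m)
    thus ?case by (simp add: Z1_def monom_Suc)
  qed
  have Z2: "Z2 ^ n = monom 1 n"
    by (simp add: Z2_def monom_altdef)
  show ?thesis by (cases i) (auto simp: Z1 Z2 coeff2_def coeff_monom)
qed

lemma da_inner_monomials:
  "da_inner (da_poly (Z1 ^ m * Z2 ^ n)) (da_poly (Z1 ^ m' * Z2 ^ n')) =
     (if (m, n) = (m', n') then 1 / of_nat ((m + n) choose m) else 0)"
proof -
  have "((\<lambda>i. coeff2 (Z1 ^ m * Z2 ^ n) i * cnj (coeff2 (Z1 ^ m' * Z2 ^ n') i) /
      of_real (mono_weight i)) has_sum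
      (if (m, n) = (m', n') then 1 / of_nat ((m + n) choose m) else 0)) UNIV"
    by (rule has_sum_finite_neutralI[of "{(m, n)}"])
       (auto simp: coeff2_monomial mono_weight_def)
  thus ?thesis unfolding da_inner_def da_coeff_poly by (rule infsumI)
qed

lemma norm_monomial: "(norm (da_poly (Z1 ^ m * Z2 ^ n)))\<^sup>2 = inverse (real ((m + n) choose m))"
proof -
  have "complex_of_real ((norm (da_poly (Z1 ^ m * Z2 ^ n)))\<^sup>2) =
      complex_of_real (inverse (real ((m + n) choose m)))"
    using da_inner_self[of "da_poly (Z1 ^ m * Z2 ^ n)"]
    unfolding norm_da_sq by (simp add: da_inner_monomials field_simps)
  thus ?thesis by (simp only: of_real_eq_iff)
qed


section \<open>Orthogonal projections\<close>

definition da_orthogonal :: "drury_arveson set \<Rightarrow> drury_arveson set" where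
  "da_orthogonal S = {f. \<forall>g\<in>S. da_inner f g = 0}"

text \<open>
  \<^typ>\<open>drury_arveson \<Rightarrow>\<^sub>L drury_arveson\<close> also contains operators that are only real-linear;
  \<open>B(H\<^sup>2\<^sub>2)\<close> is the subspace of complex-linear ones, with the same operator norm.
\<close>

definition da_bounded_ops :: "(drury_arveson \<Rightarrow>\<^sub>L drury_arveson) set" where
  "da_bounded_ops = {A. \<forall>c f. blinfun_apply A (da_scale c f) = da_scale c (blinfun_apply A f)}"

definition is_orthogonal_projection ::
  "drury_arveson set \<Rightarrow> (drury_arveson \<Rightarrow>\<^sub>L drury_arveson) \<Rightarrow> bool" where
  "is_orthogonal_projection M A \<longleftrightarrow>
     (\<forall>f. blinfun_apply A f \<in> M \<and> f - blinfun_apply A f \<in> da_orthogonal M)"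

definition orthogonal_projection ::
  "drury_arveson set \<Rightarrow> (drury_arveson \<Rightarrow>\<^sub>L drury_arveson)" where
  "orthogonal_projection M = (THE A. is_orthogonal_projection M A)"


subsection \<open>Existence and uniqueness\<close>

lemma hilbert_projection:
  fixes M :: "'a :: {real_inner, complete_space} set"
  assumes M: "subspace M" "closed M"
  obtains g where "g \<in> M" "\<And>h. h \<in> M \<Longrightarrow> inner (f - g) h = 0"
proof -
  define d where "d = infdist f M"
  have ne: "M \<noteq> {}" using M(1) subspace_0 by blast
  have d0: "d \<ge> 0" by (simp add: d_def infdist_nonneg)
  have dle: "d \<le> norm (f - h)" if "h \<in> M" for h
    unfolding d_def using infdist_le[OF that, of f] by (simp add: dist_norm)
  have "\<exists>h\<in>M. dist f h < d + 1 / real (Suc n)" for n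
  proof (rule ccontr)
    assume "\<not> (\<exists>h\<in>M. dist f h < d + 1 / real (Suc n))"
    hence "d + 1 / real (Suc n) \<le> infdist f M"
      unfolding infdist_notempty[OF ne] by (intro cINF_greatest ne) (auto simp: not_less)
    thus False by (simp add: d_def)
  qed
  then obtain x where x: "\<And>n. x n \<in> M" "\<And>n. dist f (x n) < d + 1 / real (Suc n)" by metis
  define b where "b n = 4 * ((d + 1 / real (Suc n))\<^sup>2 - d\<^sup>2)" for n
  have "b \<longlonglongrightarrow> 4 * ((d + 0)\<^sup>2 - d\<^sup>2)"
    unfolding b_def by (intro tendsto_intros LIMSEQ_Suc[OF lim_1_over_n])
  hence b0: "b \<longlonglongrightarrow> 0" by simp
  have close: "(norm (x m - x n))\<^sup>2 \<le> b N" if mn: "m \<ge> N" "n \<ge> N" for m n N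
  proof -
    have bd: "(norm (f - x k))\<^sup>2 \<le> (d + 1 / real (Suc N))\<^sup>2" if "k \<ge> N" for k
    proof (rule power_mono)
      have "1 / real (Suc k) \<le> 1 / real (Suc N)" using that by (simp add: frac_le)
      thus "norm (f - x k) \<le> d + 1 / real (Suc N)" using x(2)[of k] by (simp add: dist_norm)
    qed simp
    have "(1/2) *\<^sub>R (x m + x n) \<in> M"
      using M(1) x(1) by (intro subspace_scale subspace_add)
    from dle[OF this] have "d\<^sup>2 \<le> (norm (f - (1/2) *\<^sub>R (x m + x n)))\<^sup>2"
      using d0 by (rule power_mono)
    moreover have "(norm (x m - x n))\<^sup>2 = 2 * (norm (f - x m))\<^sup>2 + 2 * (norm (f - x n))\<^sup>2
        - 4 * (norm (f - (1/2) *\<^sub>R (x m + x n)))\<^sup>2"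
      by (simp add: power2_norm_eq_inner inner_diff_left inner_diff_right inner_add_left
          inner_add_right inner_commute algebra_simps)
    moreover have "X \<le> 4 * (A - D)"
      if "D \<le> W" "X = 2 * p + 2 * q - 4 * W" "p \<le> A" "q \<le> A" for X A D W p q :: real
      using that by (simp add: algebra_simps)
    ultimately show ?thesis
      using bd[OF mn(1)] bd[OF mn(2)] unfolding b_def by blast
  qed
  have "Cauchy x"
  proof (rule metric_CauchyI)
    fix e :: real assume e: "e > 0"
    hence "eventually (\<lambda>N. b N < e\<^sup>2) sequentially"
      by (intro order_tendstoD[OF b0]) simp
    then obtain N where N: "b N < e\<^sup>2" by (auto simp: eventually_sequentially)
    have "dist (x m) (x n) < e" if "m \<ge> N" "n \<ge> N" for m n
      using close[OF that] N e power_less_imp_less_base[of "norm (x m - x n)" 2 e]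
      by (auto simp: dist_norm)
    thus "\<exists>N. \<forall>m\<ge>N. \<forall>n\<ge>N. dist (x m) (x n) < e" by blast
  qed
  then obtain g where g: "x \<longlonglongrightarrow> g" by (meson Cauchy_convergent convergentD)
  have gM: "g \<in> M" using closed_sequentially[OF M(2) _ g] x(1) by blast
  have "norm (f - g) \<le> d"
  proof (rule LIMSEQ_le)
    show "(\<lambda>n. norm (f - x n)) \<longlonglongrightarrow> norm (f - g)" by (intro tendsto_intros g)
    have "(\<lambda>n. d + 1 / real (Suc n)) \<longlonglongrightarrow> d + 0"
      by (intro tendsto_intros LIMSEQ_Suc[OF lim_1_over_n])
    thus "(\<lambda>n. d + 1 / real (Suc n)) \<longlonglongrightarrow> d" by simp
    show "\<exists>N. \<forall>n\<ge>N. norm (f - x n) \<le> d + 1 / real (Suc n)"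
      using x(2) by (auto simp: dist_norm intro: less_imp_le)
  qed
  hence min: "norm (f - g) \<le> norm (f - h)" if "h \<in> M" for h using dle[OF that] by simp
  have "inner (f - g) h = 0" if h: "h \<in> M" for h
  proof (cases "h = 0")
    case False
    define t where "t = inner (f - g) h / inner h h"
    have "(norm (f - g))\<^sup>2 \<le> (norm (f - (g + t *\<^sub>R h)))\<^sup>2"
      using M(1) gM h by (intro power_mono min subspace_add subspace_scale) auto
    also have "\<dots> = (norm (f - g))\<^sup>2 - 2 * t * inner (f - g) h + t\<^sup>2 * inner h h"
    proof -
      have "inner (u - t *\<^sub>R h) (u - t *\<^sub>R h) = inner u u - 2 * t * inner u h + t\<^sup>2 * inner h h"
        for u
        by (simp add: inner_diff_left inner_diff_right power2_eq_square
            inner_commute algebra_simps)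
      thus ?thesis unfolding diff_diff_eq[symmetric] power2_norm_eq_inner .
    qed
    also have "\<dots> = (norm (f - g))\<^sup>2 - (inner (f - g) h)\<^sup>2 / inner h h"
      using False by (simp add: t_def power2_eq_square)
    finally have "(inner (f - g) h)\<^sup>2 / inner h h \<le> 0" by simp
    moreover have "inner h h > 0" using False by simp
    ultimately show ?thesis by (simp add: divide_le_0_iff)
  qed simp
  thus thesis using gM that by blast
qed

lemma da_inner_scale_right: "da_inner f (da_scale c g) = cnj c * da_inner f g"
  by (subst (1 2) da_inner_commute) (simp add: da_inner_scale_left)

lemma inner_da_eq: "inner f g = Re (da_inner f g)"
  by (rule inner_drury_arveson_def)

lemma da_inner_eq: "da_inner f g = Complex (inner f g) (inner f (da_scale \<i> g))"
  by (simp add: inner_da_eq da_inner_scale_right complex_eq_iff)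

lemma da_inner_zero_left [simp]: "da_inner 0 g = 0"
  by (simp add: da_inner_def da_coeff_zero)

lemma subspace_da_orthogonal: "subspace (da_orthogonal S)"
  by (auto simp: subspace_def da_orthogonal_def da_inner_add_left scaleR_drury_arveson_def
      da_inner_scale_left)

lemma da_orthogonal_scale: "f \<in> da_orthogonal S \<Longrightarrow> da_scale c f \<in> da_orthogonal S"
  by (simp add: da_orthogonal_def da_inner_scale_left)

lemma closed_da_orthogonal: "closed (da_orthogonal S)"
proof -
  have "da_orthogonal S =
      (\<Inter>g\<in>S. {f. inner f g = 0} \<inter> {f. inner f (da_scale \<i> g) = 0})"
    by (auto simp: da_orthogonal_def da_inner_eq complex_eq_iff)
  thus ?thesis
    by (auto intro!: closed_INT closed_Int closed_Collect_eq continuous_intros)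
qed

lemma da_orthogonal_Int: "f \<in> M \<Longrightarrow> f \<in> da_orthogonal M \<Longrightarrow> f = 0"
proof -
  assume "f \<in> M" "f \<in> da_orthogonal M"
  hence "inner f f = 0" by (simp add: da_orthogonal_def inner_da_eq)
  thus "f = 0" by simp
qed

lemma orthogonal_decomposition_unique:
  assumes "subspace M" "f = a + b" "f = a' + b'" "a \<in> M" "a' \<in> M"
    "b \<in> da_orthogonal M" "b' \<in> da_orthogonal M"
  shows "a = a'"
proof -
  have "a - a' \<in> M" using assms by (intro subspace_diff)
  moreover have "a - a' = b' - b" using assms(2,3) by (simp add: algebra_simps)
  hence "a - a' \<in> da_orthogonal M"
    using assms by (simp add: subspace_diff subspace_da_orthogonal)
  ultimately show ?thesis using da_orthogonal_Int by fastforce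
qed

lemma ex1_orthogonal_projection:
  assumes M: "subspace M" "closed M" "\<And>c f. f \<in> M \<Longrightarrow> da_scale c f \<in> M"
  shows "\<exists>!A. is_orthogonal_projection M A"
proof (rule ex_ex1I)
  have "\<exists>g. g \<in> M \<and> f - g \<in> da_orthogonal M" for f
  proof -
    obtain g where "g \<in> M" "\<And>h. h \<in> M \<Longrightarrow> inner (f - g) h = 0"
      using hilbert_projection[OF M(1,2)] by metis
    moreover from this have "f - g \<in> da_orthogonal M"
      using M(3) by (simp add: da_orthogonal_def da_inner_eq complex_eq_iff)
    ultimately show ?thesis by blast
  qed
  then obtain P where P: "\<And>f. P f \<in> M" "\<And>f. f - P f \<in> da_orthogonal M" by metis
  have sub: "subspace (da_orthogonal M)" by (rule subspace_da_orthogonal)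
  have "bounded_linear P"
  proof (rule bounded_linear_intro[of _ 1])
    fix f g :: drury_arveson and r :: real
    show "P (f + g) = P f + P g"
    proof (rule orthogonal_decomposition_unique[OF M(1)])
      show "f + g = P (f + g) + (f + g - P (f + g))" by simp
      show "f + g = (P f + P g) + ((f - P f) + (g - P g))" by simp
    qed (auto intro!: P subspace_add M sub)
    show "P (r *\<^sub>R f) = r *\<^sub>R P f"
    proof (rule orthogonal_decomposition_unique[OF M(1)])
      show "r *\<^sub>R f = P (r *\<^sub>R f) + (r *\<^sub>R f - P (r *\<^sub>R f))" by simp
      show "r *\<^sub>R f = r *\<^sub>R P f + r *\<^sub>R (f - P f)" by (simp add: algebra_simps)
    qed (auto intro!: P subspace_scale M sub)
    have "inner (f - P f) (P f) = 0"
      using P(2)[of f] P(1)[of f] by (simp add: da_orthogonal_def inner_da_eq)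
    hence "inner (P f) (P f) = inner f (P f)" by (simp add: inner_diff_left)
    also have "\<dots> \<le> norm f * norm (P f)" by (rule norm_cauchy_schwarz)
    finally have "norm (P f) * norm (P f) \<le> norm f * norm (P f)"
      by (simp add: power2_norm_eq_inner[symmetric] power2_eq_square)
    thus "norm (P f) \<le> norm f * 1"
      by (cases "P f = 0") (auto simp: mult_le_cancel_right)
  qed
  thus "\<exists>A. is_orthogonal_projection M A"
    unfolding is_orthogonal_projection_def
    by (intro exI[of _ "Blinfun P"]) (simp add: bounded_linear_Blinfun_apply P)
next
  fix A B assume AB: "is_orthogonal_projection M A" "is_orthogonal_projection M B"
  show "A = B"
  proof (rule blinfun_eqI)
    fix f
    show "blinfun_apply A f = blinfun_apply B f"
      by (rule orthogonal_decomposition_unique[OF M(1), of f _ "f - blinfun_apply A f"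
            _ "f - blinfun_apply B f"])
         (use AB in \<open>auto simp: is_orthogonal_projection_def\<close>)
  qed
qed

lemma is_orthogonal_projection_da_orthogonal:
  "is_orthogonal_projection (da_orthogonal S) (orthogonal_projection (da_orthogonal S))"
  unfolding orthogonal_projection_def
  by (rule theI', rule ex1_orthogonal_projection)
     (auto intro: subspace_da_orthogonal closed_da_orthogonal da_orthogonal_scale)

lemma da_scale_diff: "da_scale c (f - g) = da_scale c f - da_scale c g"
  by (rule da_eqI) (simp add: da_coeff_scale da_coeff_diff algebra_simps)

lemma orthogonal_projection_in_da_bounded_ops:
  "orthogonal_projection (da_orthogonal S) \<in> da_bounded_ops"
proof -
  let ?M = "da_orthogonal S" and ?P = "orthogonal_projection (da_orthogonal S)"
  have P: "blinfun_apply ?P f \<in> ?M" "f - blinfun_apply ?P f \<in> da_orthogonal ?M" for f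
    using is_orthogonal_projection_da_orthogonal[of S]
    by (auto simp: is_orthogonal_projection_def)
  have "blinfun_apply ?P (da_scale c f) = da_scale c (blinfun_apply ?P f)" for c f
    by (rule orthogonal_decomposition_unique[OF subspace_da_orthogonal[of S], of "da_scale c f" _
          "da_scale c f - blinfun_apply ?P (da_scale c f)" _ "da_scale c (f - blinfun_apply ?P f)"])
       (auto simp: P da_scale_diff
          intro: P da_orthogonal_scale da_orthogonal_scale[OF P(2), unfolded da_scale_diff])
  thus ?thesis by (simp add: da_bounded_ops_def)
qed

end

theory Submission
  imports Defs
begin

text \<open>
  The projections are not even norm continuous: \<open>\<parallel>P\<^sub>t - P\<^sub>s\<parallel> \<ge> 1\<close> unless \<open>t - s\<close> is a multiple of \<open>2\<pi>\<close>.
  Let \<open>c \<noteq> d\<close> have modulus \<open>\<epsilon>\<close>, and let \<open>v\<^sub>c = \<Sum>\<^sub>j (kj+n choose n) (cnj c)\<^sup>j z\<^sub>1\<^sup>k\<^sup>j z\<^sub>2\<^sup>n\<close>, which is orthogonal to the ideal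
  of \<open>z\<^sub>1\<^sup>k - c\<close>.  The projection of \<open>v\<^sub>c\<close> to the orthogonal complement of the ideal of \<open>z\<^sub>1\<^sup>k - d\<close> has
  relative norm at most \<open>|S\<^sub>n(cnj c d)| / S\<^sub>n(\<epsilon>\<^sup>2)\<close>, where \<open>S\<^sub>n(x) = \<Sum>\<^sub>j (kj+n choose n) x\<^sup>j\<close>.  If
  \<open>y\<^sup>k = x\<close>, then \<open>S\<^sub>n(x)\<close> is the average of \<open>(1 - u y)\<^sup>-\<^sup>(\<^sup>n\<^sup>+\<^sup>1\<^sup>)\<close> over the \<open>k\<close>-th roots of unity \<open>u\<close>; among all
  \<open>x\<close> of modulus \<open>\<epsilon>\<^sup>2\<close> these averages grow fastest at \<open>x = \<epsilon>\<^sup>2\<close>, so the ratio tends to \<open>0\<close>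
  as \<open>n \<rightarrow> \<infinity>\<close>.
\<close>

section \<open>Roots of unity and the multisected negative binomial series\<close>

text \<open>The roots are the powers of a primitive root \<open>w\<close>, so this is a geometric
  sum with ratio \<open>w ^ m\<close>. The ratio is 1 exactly when \<open>k\<close> divides
  \<open>m\<close>, and its \<open>k\<close>-th power is always 1.\<close>

lemma sum_powers_roots_unity:
  assumes "k > 0"
  shows "(\<Sum>u | u ^ k = 1. u ^ m) = (if k dvd m then of_nat k else (0 :: complex))"
proof -
  define w where "w = cis (2 * pi / real k)"
  have w_pow: "w ^ l = cis (2 * pi * real l / real k)" for l
    unfolding w_def Complex.DeMoivre by (simp add: mult_ac)
  have bij: "bij_betw (\<lambda>l. w ^ l) {..<k} {u. u ^ k = 1}"
    using Complex.bij_betw_roots_unity[OF assms] by (simp add: w_pow)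
  have wk: "w ^ k = 1" using assms by (simp add: w_def Complex.DeMoivre)
  have "(\<Sum>u | u ^ k = 1. u ^ m) = (\<Sum>l<k. (w ^ l) ^ m)"
    by (rule sum.reindex_bij_betw[OF bij, symmetric])
  also have "\<dots> = (\<Sum>l<k. (w ^ m) ^ l)"
    by (simp add: mult.commute flip: power_mult)
  finally have eq: "(\<Sum>u | u ^ k = 1. u ^ m) = (\<Sum>l<k. (w ^ m) ^ l)" .
  have wm: "w ^ m = w ^ (m mod k)"
    by (metis div_mult_mod_eq mult_1 power_add power_mult power_one wk mult.commute)
  show ?thesis
  proof (cases "k dvd m")
    case True
    thus ?thesis unfolding eq wm by simp
  next
    case False
    have "w ^ m \<noteq> 1"
    proof
      assume "w ^ m = 1"
      hence "w ^ (m mod k) = w ^ 0" using wm by simp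
      hence "m mod k = 0"
        using inj_onD[OF bij_betw_imp_inj_on[OF bij], of "m mod k" 0] assms by simp
      thus False using False by auto
    qed
    moreover have "(w ^ m) ^ k = 1" by (metis wk power_mult mult.commute power_one)
    ultimately show ?thesis unfolding eq using False by (simp add: geometric_sum)
  qed
qed

text \<open>This is the binomial series of \<open>1 - z\<close> with exponent \<open>-(n+1)\<close>;
  upper negation turns its coefficients into ordinary binomials.\<close>

lemma negative_binomial_sums:
  fixes z :: complex
  assumes "norm z < 1"
  shows "(\<lambda>m. of_nat ((m + n) choose n) * z ^ m) sums (1 / (1 - z) ^ Suc n)"
proof -
  have "(\<lambda>m. (- of_nat (Suc n) gchoose m) * (- z) ^ m) sums (1 + (- z)) powr (- of_nat (Suc n))"
    using assms by (intro gen_binomial_complex) simp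
  moreover have "(- of_nat (Suc n) gchoose m) * (- z) ^ m = of_nat ((m + n) choose n) * z ^ m" for m
  proof -
    have "(- of_nat (Suc n) :: complex) gchoose m = (- 1) ^ m * (of_nat (m + n) gchoose m)"
      by (subst gbinomial_minus) (simp add: add_ac)
    also have "\<dots> = (- 1) ^ m * of_nat ((m + n) choose n)"
      using binomial_symmetric[of m "m + n"] by (simp add: binomial_gbinomial[symmetric] flip: of_nat_add)
    finally show ?thesis by (simp add: power_minus[of z])
  qed
  moreover have "(1 + (- z)) powr (- of_nat (Suc n)) = 1 / (1 - z) ^ Suc n"
    by (subst powr_minus, subst powr_nat') (auto simp: divide_inverse)
  ultimately show ?thesis by simp
qed

text \<open>Absolute convergence comes from the same series at the real point \<open>norm z\<close>,
  whose terms are the norms of the original ones.\<close>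

lemma negative_binomial_has_sum:
  fixes z :: complex
  assumes "norm z < 1"
  shows "((\<lambda>m. of_nat ((m + n) choose n) * z ^ m) has_sum (1 / (1 - z) ^ Suc n)) UNIV"
proof (rule norm_summable_imp_has_sum[OF _ negative_binomial_sums[OF assms]])
  have "summable (\<lambda>m. Re (of_nat ((m + n) choose n) * of_real (norm z) ^ m))"
    using assms sums_Re[OF negative_binomial_sums[of "of_real (norm z)" n]]
    by (intro sums_summable) auto
  thus "summable (\<lambda>m. norm (of_nat ((m + n) choose n) * z ^ m))"
    by (simp add: norm_mult norm_power flip: of_real_power)
qed

text \<open>The \<open>S_n(x)\<close> of the overview. At \<open>cnj c * d\<close> it is the inner
  product of the kernel vectors of \<open>c\<close> and \<open>d\<close> introduced below.\<close>

definition multisection_sum :: "nat \<Rightarrow> nat \<Rightarrow> complex \<Rightarrow> complex" where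
  "multisection_sum k n x = (\<Sum>\<^sub>\<infinity>j. of_nat ((k * j + n) choose n) * x ^ j)"

lemma has_sum_finite_sum:
  fixes f :: "'a \<Rightarrow> 'b \<Rightarrow> 'c :: topological_comm_monoid_add"
  assumes "finite I" "\<And>i. i \<in> I \<Longrightarrow> (f i has_sum s i) A"
  shows "((\<lambda>x. \<Sum>i\<in>I. f i x) has_sum (\<Sum>i\<in>I. s i)) A"
  using assms by (induction I rule: finite_induct) (auto intro: has_sum_add)

text \<open>Averaging the full series at the points \<open>u * y\<close> cancels every exponent not
  divisible by \<open>k\<close>.\<close>

lemma multisection_has_sum_roots:
  fixes y :: complex
  assumes k: "k > 0" and y: "norm y < 1"
  shows "((\<lambda>j. of_nat ((k * j + n) choose n) * (y ^ k) ^ j) has_sum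
           (\<Sum>u | u ^ k = 1. 1 / (1 - u * y) ^ Suc n) / of_nat k) UNIV"
proof -
  let ?b = "\<lambda>m. of_nat ((m + n) choose n) :: complex"
  let ?S = "\<Sum>u | u ^ k = 1. 1 / (1 - u * y) ^ Suc n"
  have "((\<lambda>m. ?b m * (u * y) ^ m) has_sum 1 / (1 - u * y) ^ Suc n) UNIV" if "u ^ k = 1" for u :: complex
  proof (rule negative_binomial_has_sum)
    have "norm u ^ k = 1" using that by (metis norm_one norm_power)
    hence "norm u = 1" using k power_eq_imp_eq_base[of "norm u" k 1] by simp
    thus "norm (u * y) < 1" using y by (simp add: norm_mult)
  qed
  hence "((\<lambda>m. \<Sum>u | u ^ k = 1. ?b m * (u * y) ^ m) has_sum ?S) UNIV"
    using k by (intro has_sum_finite_sum) (auto simp: finite_roots_unity)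
  moreover have "(\<Sum>u | u ^ k = 1. ?b m * (u * y) ^ m) = (if k dvd m then of_nat k * (?b m * y ^ m) else 0)"
    for m
  proof -
    have "(\<Sum>u | u ^ k = 1. ?b m * (u * y) ^ m) = ?b m * y ^ m * (\<Sum>u | u ^ k = 1. u ^ m)"
      by (simp add: power_mult_distrib sum_distrib_left mult_ac)
    thus ?thesis by (simp add: sum_powers_roots_unity[OF k])
  qed
  ultimately have "((\<lambda>m. if k dvd m then of_nat k * (?b m * y ^ m) else 0) has_sum ?S) UNIV"
    by simp
  also have "?this \<longleftrightarrow> ((\<lambda>m. of_nat k * (?b m * y ^ m)) has_sum ?S) (range ((*) k))"
    by (rule has_sum_cong_neutral) auto
  also have "\<dots> \<longleftrightarrow> ((\<lambda>j. of_nat k * (?b (k * j) * (y ^ k) ^ j)) has_sum ?S) UNIV"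
    using k by (subst has_sum_reindex) (auto simp: inj_on_def o_def power_mult)
  finally have "((\<lambda>j. of_nat k * (?b (k * j) * (y ^ k) ^ j) * inverse (of_nat k)) has_sum
      ?S * inverse (of_nat k)) UNIV"
    by (rule has_sum_cmult_left)
  moreover have "of_nat k * z * inverse (of_nat k) = z" for z :: complex
    using k by simp
  ultimately show ?thesis by (simp only: divide_inverse)
qed

text \<open>A \<open>k\<close>-th root of \<open>x\<close> also lies in the open unit disc, so the
  root-of-unity formula yields summability.\<close>

lemma multisection_has_sum:
  assumes "k > 0" "norm x < 1"
  shows "((\<lambda>j. of_nat ((k * j + n) choose n) * x ^ j) has_sum multisection_sum k n x) UNIV"
proof -
  obtain y where y: "x = y ^ k"
    using assms(1) by (auto intro: exists_complex_root[of k x])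
  hence "norm y ^ k = norm x" by (metis norm_power)
  hence "norm y < 1" using assms by (metis norm_ge_zero not_le one_le_power)
  from multisection_has_sum_roots[OF assms(1) this, of n] show ?thesis
    unfolding multisection_sum_def y by (intro has_sum_infsum has_sum_imp_summable)
qed

lemma multisection_sum_roots:
  "k > 0 \<Longrightarrow> norm y < 1 \<Longrightarrow>
    multisection_sum k n (y ^ k) = (\<Sum>u | u ^ k = 1. 1 / (1 - u * y) ^ Suc n) / of_nat k"
  unfolding multisection_sum_def by (intro infsumI multisection_has_sum_roots)

section \<open>Growth of the multisection sums as \<open>n\<close> tends to infinity\<close>

text \<open>On the circle of radius \<open>r\<close>, the point \<open>r\<close> alone attains the
  minimal distance \<open>1 - r\<close> to 1; elsewhere the quotient has modulus below 1.\<close>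

lemma dominant_power_limit:
  fixes z :: complex
  assumes "0 < r" "r < 1" "norm z = r"
  shows "(\<lambda>n. (of_real (1 - r) / (1 - z)) ^ Suc n) \<longlonglongrightarrow> (if z = of_real r then 1 else 0)"
proof (cases "z = of_real r")
  case True
  have "(1 - of_real r :: complex) \<noteq> 0"
    using assms(2) by (metis eq_iff_diff_eq_0 less_irrefl of_real_1 of_real_eq_iff)
  thus ?thesis using True by simp
next
  case False
  have "Re z < r"
  proof (rule ccontr)
    assume "\<not> Re z < r"
    hence "Re z = r" using complex_Re_le_cmod[of z] assms by simp
    moreover from this have "Im z = 0" using assms cmod_power2[of z] by simp
    ultimately show False using False by (simp add: complex_eq_iff)
  qed
  hence "1 - r < norm (1 - z)" using complex_Re_le_cmod[of "1 - z"] by simp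
  moreover have "norm (of_real (1 - r) :: complex) = 1 - r" using assms by (simp only: norm_of_real)
  ultimately have "norm (of_real (1 - r) / (1 - z)) < 1"
    using assms unfolding norm_divide by (simp add: divide_simps)
  from LIMSEQ_Suc[OF LIMSEQ_power_zero[OF this]] show ?thesis using False by simp
qed

text \<open>The factor \<open>(1 - r) ^ Suc n\<close> normalises the largest possible term
  \<open>1 / (1 - u * y) ^ Suc n\<close>. In the limit only a root with \<open>u * y = r\<close>
  survives, and one exists exactly when \<open>x = r ^ k\<close>.\<close>

lemma multisection_sum_asymptotics:
  assumes k: "k > 0" and r: "0 < r" "r < 1" and x: "norm x = r ^ k"
  shows "(\<lambda>n. of_real (1 - r) ^ Suc n * multisection_sum k n x) \<longlonglongrightarrow>
           (if x = of_real r ^ k then 1 / of_nat k else 0)"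
proof -
  \<comment> \<open>When \<open>x = r ^ k\<close>, choosing the root \<open>y = r\<close> makes
    \<open>u = 1\<close> the surviving root of unity.\<close>
  obtain y where y: "y ^ k = x" "x = of_real r ^ k \<Longrightarrow> y = of_real r"
  proof (cases "x = of_real r ^ k")
    case True
    with that show ?thesis by blast
  next
    case False
    obtain y where "x = y ^ k" using k by (auto intro: exists_complex_root[of k x])
    with that[of y] False show ?thesis by blast
  qed
  have "norm y ^ k = r ^ k" using x y by (metis norm_power)
  hence ny: "norm y = r" using r k by (simp add: power_eq_iff_eq_base)
  have nu: "norm (u * y) = r" if "u ^ k = 1" for u
  proof -
    have "norm (u * y) ^ k = r ^ k" using that x y(1) by (simp add: power_mult_distrib flip: norm_power)
    thus ?thesis using r k by (simp add: power_eq_iff_eq_base)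
  qed
  have eq: "of_real (1 - r) ^ Suc n * multisection_sum k n x =
      (\<Sum>u | u ^ k = 1. (of_real (1 - r) / (1 - u * y)) ^ Suc n) / of_nat k" for n
    using multisection_sum_roots[OF k, of y n] ny r y(1)
    by (simp add: sum_distrib_left power_divide)
  have "(\<lambda>n. (\<Sum>u | u ^ k = 1. (of_real (1 - r) / (1 - u * y)) ^ Suc n) / of_nat k) \<longlonglongrightarrow>
      (\<Sum>u | u ^ k = 1. if u * y = of_real r then 1 else 0) / of_nat k"
    using k nu r by (intro tendsto_intros dominant_power_limit) auto
  moreover have "(\<Sum>u | u ^ k = 1. if u * y = of_real r then 1 else 0 :: complex) =
      (if x = of_real r ^ k then 1 else 0)"
  proof (cases "x = of_real r ^ k")
    case True
    hence "u * y = of_real r \<longleftrightarrow> u = 1" for u using r y(2) by simp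
    moreover have "finite {u :: complex. u ^ k = 1}" using k by (simp add: finite_roots_unity)
    ultimately show ?thesis using True by simp
  next
    case False
    have "u * y \<noteq> of_real r" if "u ^ k = 1" for u
      using False that y(1) by (metis mult_1 power_mult_distrib)
    thus ?thesis using False by (auto intro: sum.neutral)
  qed
  ultimately show ?thesis unfolding eq by (auto split: if_splits)
qed

text \<open>With \<open>r\<close> the \<open>k\<close>-th root of \<open>s\<close>, the normalising
  powers cancel in the quotient, and the denominator has the nonzero limit
  \<open>1 / k\<close>.\<close>

lemma multisection_sum_ratio_tendsto_0:
  assumes k: "k > 0" and "0 < s" "s < 1" "norm x = s" "x \<noteq> of_real s"
  shows "(\<lambda>n. multisection_sum k n x / multisection_sum k n (of_real s)) \<longlonglongrightarrow> 0"
proof -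
  define r where "r = root k s"
  have r: "0 < r" "r < 1" "r ^ k = s" using assms by (auto simp: r_def)
  have rs: "of_real r ^ k = (of_real s :: complex)" using r(3) by (simp flip: of_real_power)
  have "(\<lambda>n. (of_real (1 - r) ^ Suc n * multisection_sum k n x) /
      (of_real (1 - r) ^ Suc n * multisection_sum k n (of_real s))) \<longlonglongrightarrow> 0 / (1 / of_nat k)"
    using multisection_sum_asymptotics[OF k r(1,2), of x]
      multisection_sum_asymptotics[OF k r(1,2), of "of_real s"] r rs assms
    by (intro tendsto_divide) simp_all
  moreover have "(of_real (1 - r) :: complex) \<noteq> 0" using r by (simp only: of_real_eq_0_iff)
  ultimately show ?thesis by (simp del: of_real_diff)
qed

section \<open>Linear structure of \<open>da_poly\<close> and \<open>da_inner\<close>\<close>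

lemma coeff2_add: "coeff2 (p + q) = (\<lambda>i. coeff2 p i + coeff2 q i)"
  by (auto simp: coeff2_def)

lemma coeff2_diff: "coeff2 (p - q) = (\<lambda>i. coeff2 p i - coeff2 q i)"
  by (auto simp: coeff2_def)

lemma coeff2_const2_mult: "coeff2 (const2 c * q) = (\<lambda>i. c * coeff2 q i)"
  by (auto simp: coeff2_def const2_def)

lemma da_poly_0: "da_poly 0 = 0"
  by (rule da_eqI) (auto simp: da_coeff_poly da_coeff_zero coeff2_def)

lemma da_poly_add: "da_poly (p + q) = da_poly p + da_poly q"
  by (rule da_eqI) (simp add: da_coeff_poly da_coeff_add coeff2_add)

lemma da_poly_diff: "da_poly (p - q) = da_poly p - da_poly q"
  by (rule da_eqI) (simp add: da_coeff_poly da_coeff_diff coeff2_diff)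

lemma da_poly_const2_mult: "da_poly (const2 c * q) = da_scale c (da_poly q)"
  by (rule da_eqI) (simp add: da_coeff_poly da_coeff_scale coeff2_const2_mult)

lemma da_inner_zero_right [simp]: "da_inner f 0 = 0"
  by (simp add: da_inner_def da_coeff_zero)

lemma da_inner_add_right: "da_inner f (g + h) = da_inner f g + da_inner f h"
  by (subst (1 2 3) da_inner_commute) (simp add: da_inner_add_left)

lemma da_inner_diff_left: "da_inner (f - g) h = da_inner f h - da_inner g h"
  using da_inner_add_left[of "f - g" g h] by simp

lemma da_inner_diff_right: "da_inner f (g - h) = da_inner f g - da_inner f h"
  using da_inner_add_right[of f "g - h" h] by simp

lemma da_inner_self_norm: "da_inner f f = of_real ((norm f)\<^sup>2)"
  by (simp only: da_inner_self norm_da_sq)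

text \<open>A unimodular factor \<open>u\<close> rotates the complex inner product to a nonnegative
  real, where the inequality for the real product \<open>inner\<close> applies.\<close>

lemma da_inner_Cauchy_Schwarz: "norm (da_inner f g) \<le> norm f * norm g"
proof (cases "da_inner f g = 0")
  case False
  define u where "u = cnj (da_inner f g) / of_real (norm (da_inner f g))"
  have nu: "cnj u * u = 1"
    using False by (simp add: u_def complex_norm_square[symmetric] power2_eq_square)
  have "(norm (da_scale u f))\<^sup>2 = (norm f)\<^sup>2"
  proof -
    have "da_inner (da_scale u f) (da_scale u f) = da_inner f f"
      using nu by (simp add: da_inner_scale_left da_inner_scale_right mult.assoc[symmetric] mult.commute)
    thus ?thesis unfolding da_inner_self_norm of_real_eq_iff .
  qed
  hence nf: "norm (da_scale u f) = norm f" by simp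
  have "of_real (norm (da_inner f g)) = da_inner (da_scale u f) g"
    using False by (simp add: da_inner_scale_left u_def complex_norm_square[symmetric] power2_eq_square
        mult.commute)
  hence "norm (da_inner f g) = inner (da_scale u f) g"
    unfolding inner_da_eq by (metis Re_complex_of_real)
  also have "\<dots> \<le> norm f * norm g" using norm_cauchy_schwarz[of "da_scale u f" g] nf by simp
  finally show ?thesis .
qed simp

lemma da_inner_monomial:
  "da_inner f (da_poly (Z1 ^ m * Z2 ^ n)) = da_coeff f (m, n) / of_nat ((m + n) choose n)"
proof -
  have "((\<lambda>i. da_coeff f i * cnj (coeff2 (Z1 ^ m * Z2 ^ n) i) / of_real (mono_weight i)) has_sum
      (da_coeff f (m, n) / of_nat ((m + n) choose n))) UNIV"
    using binomial_symmetric[of m "m + n"]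
    by (intro has_sum_finite_neutralI[of "{(m, n)}"]) (auto simp: coeff2_monomial mono_weight_def)
  thus ?thesis unfolding da_inner_def da_coeff_poly by (rule infsumI)
qed

section \<open>The orthogonal complements of the ideals and their kernel vectors\<close>

definition quotient_space :: "nat \<Rightarrow> complex \<Rightarrow> drury_arveson set" where
  "quotient_space k c = da_orthogonal (da_poly ` principal_ideal (Z1 ^ k - const2 c))"

text \<open>The monomial multiples of \<open>Z1 ^ k - const2 c\<close> span the ideal, so
  orthogonality to it is a recurrence along each row of fixed degree in \<open>Z2\<close>.\<close>

lemma quotient_space_iff:
  "f \<in> quotient_space k c \<longleftrightarrow>
    (\<forall>m n. da_inner f (da_poly (Z1 ^ (m + k) * Z2 ^ n)) = cnj c * da_inner f (da_poly (Z1 ^ m * Z2 ^ n)))"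
    (is "_ \<longleftrightarrow> ?R")
proof -
  let ?p = "Z1 ^ k - const2 c"
  have mono: "da_inner f (da_poly (Z1 ^ m * Z2 ^ n * ?p)) =
      da_inner f (da_poly (Z1 ^ (m + k) * Z2 ^ n)) - cnj c * da_inner f (da_poly (Z1 ^ m * Z2 ^ n))" for m n
  proof -
    have "Z1 ^ m * Z2 ^ n * ?p = Z1 ^ (m + k) * Z2 ^ n - const2 c * (Z1 ^ m * Z2 ^ n)"
      by (simp add: power_add algebra_simps)
    thus ?thesis by (simp only: da_poly_diff da_poly_const2_mult da_inner_diff_right da_inner_scale_right)
  qed
  have mem: "f \<in> quotient_space k c \<longleftrightarrow> (\<forall>q. da_inner f (da_poly (q * ?p)) = 0)"
    by (auto simp: quotient_space_def da_orthogonal_def principal_ideal_def)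
  show ?thesis
  proof
    assume "f \<in> quotient_space k c"
    thus ?R using mono unfolding mem by (metis eq_iff_diff_eq_0)
  next
    assume R: ?R
    \<comment> \<open>Here \<open>[:a:]\<close> is a polynomial in \<open>Z1\<close> alone; the
      induction over powers of \<open>Z2\<close> follows, with this as its coefficient case.\<close>
    have row: "da_inner f (da_poly (Z1 ^ m * Z2 ^ n * [:a:] * ?p)) = 0" for m n a
    proof (induction a arbitrary: m)
      case 0
      show ?case by (simp add: da_poly_0)
    next
      case (pCons b a)
      have "[:pCons b a:] = const2 b + Z1 * [:a:]" by (simp add: const2_def Z1_def)
      hence "Z1 ^ m * Z2 ^ n * [:pCons b a:] * ?p =
          const2 b * (Z1 ^ m * Z2 ^ n * ?p) + Z1 ^ Suc m * Z2 ^ n * [:a:] * ?p"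
        by (simp only: power_Suc) (simp only: algebra_simps)
      moreover have "da_inner f (da_poly (Z1 ^ m * Z2 ^ n * ?p)) = 0" using mono R by simp
      ultimately show ?case
        by (simp only: da_poly_add da_inner_add_right da_poly_const2_mult da_inner_scale_right pCons.IH)
          simp
    qed
    have "da_inner f (da_poly (Z2 ^ n * q * ?p)) = 0" for n q
    proof (induction q arbitrary: n)
      case 0
      show ?case by (simp add: da_poly_0)
    next
      case (pCons a q)
      have "pCons a q = [:a:] + Z2 * q" by (simp add: Z2_def)
      hence "Z2 ^ n * pCons a q * ?p = Z1 ^ 0 * Z2 ^ n * [:a:] * ?p + Z2 ^ Suc n * q * ?p"
        by (simp only: power_Suc power_0 mult_1_left) (simp only: algebra_simps)
      thus ?case by (simp only: da_poly_add da_inner_add_right row pCons.IH) simp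
    qed
    from this[of 0] show "f \<in> quotient_space k c" unfolding mem by simp
  qed
qed

text \<open>The coefficients of \<open>v_c\<close>. The binomial cancels the weight of the monomial,
  so pairing with \<open>Z1 ^ (k * j) * Z2 ^ n\<close> gives \<open>cnj c ^ j\<close>, as the
  recurrence in \<open>quotient_space_iff\<close> demands.\<close>

definition kernel_coeff :: "nat \<Rightarrow> nat \<Rightarrow> complex \<Rightarrow> nat \<times> nat \<Rightarrow> complex" where
  "kernel_coeff k n c = (\<lambda>(m, n').
     if n' = n \<and> k dvd m then of_nat ((m + n) choose n) * cnj c ^ (m div k) else 0)"

lemma has_sum_multisection_iff:
  fixes g :: "nat \<times> nat \<Rightarrow> 'a :: {comm_monoid_add, topological_space}"
  assumes "k > 0" "\<And>m n'. \<not> (n' = n \<and> k dvd m) \<Longrightarrow> g (m, n') = 0"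
  shows "(g has_sum S) UNIV \<longleftrightarrow> ((\<lambda>j. g (k * j, n)) has_sum S) UNIV"
proof -
  have "(g has_sum S) UNIV \<longleftrightarrow> (g has_sum S) (range (\<lambda>j. (k * j, n)))"
    using assms(2) by (intro has_sum_cong_neutral) (auto simp: image_iff dvd_def)
  also have "\<dots> \<longleftrightarrow> ((\<lambda>j. g (k * j, n)) has_sum S) UNIV"
    using assms(1) by (subst has_sum_reindex) (auto simp: inj_on_def o_def)
  finally show ?thesis .
qed

lemma mono_weight_eq: "mono_weight (m, n) = real ((m + n) choose n)"
  using binomial_symmetric[of m "m + n"] by (simp add: mono_weight_def)

text \<open>The weighted squares form the multisection series at
  \<open>(norm c)\<^sup>2\<close>.\<close>

lemma weighted_l2_kernel_coeff:
  assumes k: "k > 0" and c: "norm c < 1"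
  shows "weighted_l2 (kernel_coeff k n c)"
proof -
  have "norm (of_real ((norm c)\<^sup>2) :: complex) < 1"
    using c by (simp add: power_less_one_iff abs_square_less_1 del: of_real_power)
  from has_sum_Re[OF multisection_has_sum[OF k this, of n]]
  have "((\<lambda>j. real ((k * j + n) choose n) * ((norm c)\<^sup>2) ^ j) has_sum
      Re (multisection_sum k n (of_real ((norm c)\<^sup>2)))) UNIV"
    by (simp flip: of_real_power)
  also have "(\<lambda>j. real ((k * j + n) choose n) * ((norm c)\<^sup>2) ^ j) =
      (\<lambda>j. (cmod (kernel_coeff k n c (k * j, n)))\<^sup>2 / mono_weight (k * j, n))"
  proof
    fix j
    have "real ((k * j + n) choose n) > 0" by (simp add: zero_less_binomial)
    thus "real ((k * j + n) choose n) * ((norm c)\<^sup>2) ^ j =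
        (cmod (kernel_coeff k n c (k * j, n)))\<^sup>2 / mono_weight (k * j, n)"
      using k by (simp add: kernel_coeff_def mono_weight_eq norm_mult norm_power power_mult_distrib
          power2_eq_square)
  qed
  finally show ?thesis
    unfolding weighted_l2_def
    by (intro has_sum_imp_summable, subst has_sum_multisection_iff[OF k, of n])
       (auto simp: kernel_coeff_def)
qed

definition da_kernel :: "nat \<Rightarrow> nat \<Rightarrow> complex \<Rightarrow> drury_arveson" where
  "da_kernel k n c = (SOME f. da_coeff f = kernel_coeff k n c)"

lemma da_coeff_kernel:
  assumes "k > 0" "norm c < 1"
  shows "da_coeff (da_kernel k n c) = kernel_coeff k n c"
proof -
  obtain f where "da_coeff f = kernel_coeff k n c"
    using da_coeff_surj[OF weighted_l2_kernel_coeff[OF assms]] .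
  thus ?thesis unfolding da_kernel_def by (rule someI)
qed

lemma kernel_in_quotient_space:
  assumes "k > 0" "norm c < 1"
  shows "da_kernel k n c \<in> quotient_space k c"
  using assms
  by (auto simp: quotient_space_iff da_inner_monomial da_coeff_kernel kernel_coeff_def)

text \<open>Iterating the recurrence from degree 0 in \<open>Z1\<close> leaves
  \<open>da_coeff f (0, n)\<close> as the only free parameter.\<close>

lemma quotient_space_coeff:
  assumes "f \<in> quotient_space k d"
  shows "da_coeff f (k * j, n) = of_nat ((k * j + n) choose n) * cnj d ^ j * da_coeff f (0, n)"
proof -
  have "da_inner f (da_poly (Z1 ^ (k * j) * Z2 ^ n)) = cnj d ^ j * da_coeff f (0, n)"
  proof (induction j)
    case 0
    show ?case using da_inner_monomial[of f 0 n] by simp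
  next
    case (Suc j)
    have "da_inner f (da_poly (Z1 ^ (k * j + k) * Z2 ^ n)) =
        cnj d * da_inner f (da_poly (Z1 ^ (k * j) * Z2 ^ n))"
      using assms unfolding quotient_space_iff by blast
    thus ?case using Suc.IH by (simp add: add.commute)
  qed
  thus ?thesis unfolding da_inner_monomial by (simp add: divide_eq_eq mult_ac split: if_splits)
qed

text \<open>The kernel vector is supported exactly where \<open>quotient_space_coeff\<close>
  determines \<open>f\<close>.\<close>

lemma inner_kernel_quotient_space:
  assumes k: "k > 0" and c: "norm c < 1" and d: "norm d < 1" and f: "f \<in> quotient_space k d"
  shows "da_inner (da_kernel k n c) f = cnj (da_coeff f (0, n)) * multisection_sum k n (cnj c * d)"
proof -
  let ?t = "\<lambda>i. kernel_coeff k n c i * cnj (da_coeff f i) / of_real (mono_weight i)"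
  have "norm (cnj c * d) < 1"
    using mult_strict_mono'[OF c d] by (simp add: norm_mult)
  hence "((\<lambda>j. cnj (da_coeff f (0, n)) * (of_nat ((k * j + n) choose n) * (cnj c * d) ^ j)) has_sum
      cnj (da_coeff f (0, n)) * multisection_sum k n (cnj c * d)) UNIV"
    by (intro has_sum_cmult_right multisection_has_sum k)
  also have "(\<lambda>j. cnj (da_coeff f (0, n)) * (of_nat ((k * j + n) choose n) * (cnj c * d) ^ j)) =
      (\<lambda>j. ?t (k * j, n))"
  proof
    fix j
    have "of_nat ((k * j + n) choose n) \<noteq> (0 :: complex)" by simp
    thus "cnj (da_coeff f (0, n)) * (of_nat ((k * j + n) choose n) * (cnj c * d) ^ j) = ?t (k * j, n)"
      using k by (simp add: quotient_space_coeff[OF f] kernel_coeff_def mono_weight_eq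
          power_mult_distrib)
  qed
  finally have "(?t has_sum cnj (da_coeff f (0, n)) * multisection_sum k n (cnj c * d)) UNIV"
    by (subst has_sum_multisection_iff[OF k, of n]) (auto simp: kernel_coeff_def)
  thus ?thesis unfolding da_inner_def da_coeff_kernel[OF k c] by (rule infsumI)
qed

text \<open>The case of \<open>inner_kernel_quotient_space\<close> where \<open>f\<close> is the
  kernel vector itself, whose coefficient at \<open>(0, n)\<close> is 1.\<close>

lemma norm_kernel:
  assumes "k > 0" "norm c < 1"
  shows "multisection_sum k n (of_real ((norm c)\<^sup>2)) = of_real ((norm (da_kernel k n c))\<^sup>2)"
    and "norm (da_kernel k n c) > 0"
proof -
  have c0: "da_coeff (da_kernel k n c) (0, n) = 1"
    using assms by (simp add: da_coeff_kernel kernel_coeff_def)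
  show "multisection_sum k n (of_real ((norm c)\<^sup>2)) = of_real ((norm (da_kernel k n c))\<^sup>2)"
    using inner_kernel_quotient_space[OF assms assms(2) kernel_in_quotient_space[OF assms], of n n] c0
    by (simp only: da_inner_self_norm complex_norm_square) (simp add: mult.commute)
  have "da_kernel k n c \<noteq> 0" using c0 by (auto simp: da_coeff_zero)
  thus "norm (da_kernel k n c) > 0" by simp
qed

section \<open>Norm distance between the projections\<close>

text \<open>Let \<open>g\<close> be the projection of \<open>v\<close>. Pairing \<open>g\<close>
  with \<open>v\<close> gives \<open>(norm g)\<^sup>2 = b * S\<close>; pairing it with the kernel
  vector of \<open>d\<close> gives \<open>b * N \<le> norm g\<close> by Cauchy-Schwarz. Together
  these yield \<open>norm g * N \<le> S\<close>.\<close>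

lemma norm_projection_kernel_le:
  assumes k: "k > 0" and c: "norm c < 1" and d: "norm d = norm c"
  shows "norm (blinfun_apply (orthogonal_projection (quotient_space k d)) (da_kernel k n c)) \<le>
    norm (multisection_sum k n (cnj c * d) / multisection_sum k n (of_real ((norm c)\<^sup>2))) * norm (da_kernel k n c)"
proof -
  define v g where "v = da_kernel k n c"
    and "g = blinfun_apply (orthogonal_projection (quotient_space k d)) v"
  define N S where "N = norm v" and "S = norm (multisection_sum k n (cnj c * d))"
  define b where "b = norm (da_coeff g (0, n))"
  have d1: "norm d < 1" using c d by simp
  have N: "N > 0" "norm (multisection_sum k n (of_real ((norm c)\<^sup>2))) = N\<^sup>2"
    unfolding norm_kernel(1)[OF k c] norm_of_real
    using norm_kernel(2)[OF k c] by (simp_all add: N_def v_def)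
  \<comment> \<open>Both squared norms are the same multisection value, as
    \<open>norm d = norm c\<close>.\<close>
  have Nd: "norm (da_kernel k n d) = N"
    using norm_kernel[OF k c, of n] norm_kernel[OF k d1, of n] unfolding d N_def v_def
    by (metis norm_ge_zero of_real_eq_iff power2_eq_imp_eq)
  have gQ: "g \<in> quotient_space k d" "v - g \<in> da_orthogonal (quotient_space k d)"
    using is_orthogonal_projection_da_orthogonal unfolding g_def quotient_space_def
      is_orthogonal_projection_def by blast+
  have "da_inner (v - g) g = 0" using gQ by (simp add: da_orthogonal_def)
  hence "da_inner v g = of_real ((norm g)\<^sup>2)" by (simp only: da_inner_diff_left da_inner_self_norm) simp
  hence g2: "(norm g)\<^sup>2 = b * S"
    using arg_cong[OF inner_kernel_quotient_space[OF k c d1 gQ(1), of n], of norm]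
    by (simp add: v_def b_def S_def norm_mult norm_power)
  have "b * N\<^sup>2 = norm (da_inner (da_kernel k n d) g)"
  proof -
    have "cnj d * d = of_real ((norm d)\<^sup>2)" by (simp only: complex_norm_square mult.commute)
    thus ?thesis
      using inner_kernel_quotient_space[OF k d1 d1 gQ(1), of n] N(2)
      by (simp add: b_def norm_mult d)
  qed
  also have "\<dots> \<le> N * norm g" using da_inner_Cauchy_Schwarz[of "da_kernel k n d" g] Nd by simp
  finally have "N * (b * N) \<le> N * norm g" by (simp add: power2_eq_square mult_ac)
  hence bN: "b * N \<le> norm g" using N(1) by (simp only: mult_le_cancel_left_pos)
  have "norm g * (norm g * N) = S * (b * N)" using g2 by (simp add: power2_eq_square mult_ac)
  also have "\<dots> \<le> S * norm g" using bN by (intro mult_left_mono) (simp_all add: S_def)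
  finally have "norm g * (norm g * N) \<le> norm g * S" by (simp add: mult.commute)
  hence "norm g * N \<le> S" by (cases "g = 0") (simp_all add: S_def)
  hence "norm g \<le> S / N\<^sup>2 * N" using N(1) by (simp add: field_simps power2_eq_square)
  thus ?thesis using N(2) by (simp add: g_def v_def N_def S_def norm_divide)
qed

text \<open>\<open>P c\<close> fixes the kernel vector of \<open>c\<close>, while \<open>P d\<close>
  shrinks it by the factor \<open>norm (q n)\<close>, which tends to 0.\<close>

theorem norm_projection_diff_ge_1:
  assumes k: "k > 0" and \<epsilon>: "0 < \<epsilon>" "\<epsilon> < 1" and c: "norm c = \<epsilon>" and d: "norm d = \<epsilon>" and "c \<noteq> d"
  shows "1 \<le> norm (orthogonal_projection (quotient_space k c) - orthogonal_projection (quotient_space k d))"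
proof -
  define P where "P x = orthogonal_projection (quotient_space k x)" for x
  define q where "q n = multisection_sum k n (cnj c * d) / multisection_sum k n (of_real (\<epsilon>\<^sup>2))" for n
  \<comment> \<open>Equality would give \<open>cnj c * d = cnj c * c\<close>, hence
    \<open>d = c\<close>.\<close>
  have "cnj c * d \<noteq> of_real (\<epsilon>\<^sup>2)"
  proof
    assume "cnj c * d = of_real (\<epsilon>\<^sup>2)"
    hence "cnj c * d = cnj c * c" using c complex_norm_square[of c] by (simp add: mult.commute)
    thus False using c \<epsilon> \<open>c \<noteq> d\<close> by auto
  qed
  moreover have "\<epsilon>\<^sup>2 < 1" using \<epsilon> by (simp add: abs_square_less_1)
  moreover have "norm (cnj c * d) = \<epsilon>\<^sup>2"
    using c d by (simp add: norm_mult power2_eq_square)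
  ultimately have "q \<longlonglongrightarrow> 0"
    unfolding q_def using k \<epsilon> by (intro multisection_sum_ratio_tendsto_0) auto
  hence lim: "(\<lambda>n. 1 - norm (q n)) \<longlonglongrightarrow> 1 - norm (0 :: complex)"
    by (intro tendsto_intros)
  have "1 - norm (q n) \<le> norm (P c - P d)" for n
  proof -
    define v where "v = da_kernel k n c"
    have c1: "norm c < 1" using c \<epsilon> by simp
    have v: "norm v > 0" unfolding v_def using norm_kernel(2)[OF k c1] .
    have "blinfun_apply (P c) v = v"
    proof (rule orthogonal_decomposition_unique[of "quotient_space k c" v _ "v - blinfun_apply (P c) v" v 0])
      show "blinfun_apply (P c) v \<in> quotient_space k c"
        "v - blinfun_apply (P c) v \<in> da_orthogonal (quotient_space k c)"
        using is_orthogonal_projection_da_orthogonal unfolding P_def quotient_space_def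
          is_orthogonal_projection_def by blast+
      show "v \<in> quotient_space k c" unfolding v_def by (rule kernel_in_quotient_space[OF k c1])
    qed (auto simp: quotient_space_def subspace_da_orthogonal subspace_0)
    moreover have "norm (blinfun_apply (P d) v) \<le> norm (q n) * norm v"
      using norm_projection_kernel_le[OF k c1, of d n] c d by (simp add: P_def v_def q_def)
    moreover have "norm v - norm (blinfun_apply (P d) v) \<le> norm (v - blinfun_apply (P d) v)"
      by (rule norm_triangle_ineq2)
    moreover have "norm (blinfun_apply (P c - P d) v) \<le> norm (P c - P d) * norm v"
      by (rule norm_blinfun)
    ultimately have "(1 - norm (q n)) * norm v \<le> norm (P c - P d) * norm v"
      by (simp add: blinfun.diff_left algebra_simps)
    thus ?thesis using v by (simp only: mult_le_cancel_right_pos)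
  qed
  with LIMSEQ_le_const2[OF lim] show ?thesis by (simp add: P_def)
qed

text \<open>Differentiability at 0 would imply norm continuity there, but arbitrarily small
  \<open>t > 0\<close> keep \<open>P t\<close> at distance at least 1 from
  \<open>P 0\<close>.\<close>

theorem proposition2p10:
  fixes k :: nat and \<epsilon> :: real and P :: "real \<Rightarrow> drury_arveson \<Rightarrow>\<^sub>L drury_arveson"
  assumes "k \<ge> 1" and "0 < \<epsilon>" and "\<epsilon> < 1"
    and "\<And>t. P t = orthogonal_projection
           (da_orthogonal (da_poly ` principal_ideal
              (Z1 ^ k - const2 (of_real \<epsilon> * exp (\<i> * of_real t)))))"
  shows "\<not> (\<forall>t. \<exists>D\<in>da_bounded_ops. (P has_vector_derivative D) (at t))"
proof
  assume "\<forall>t. \<exists>D\<in>da_bounded_ops. (P has_vector_derivative D) (at t)"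
  then obtain D where "(P has_vector_derivative D) (at 0)" by blast
  hence "isCont P 0" by (rule has_vector_derivative_continuous)
  then obtain \<delta> where \<delta>: "\<delta> > 0" "\<And>t. dist t 0 < \<delta> \<Longrightarrow> dist (P t) (P 0) < 1"
    unfolding continuous_at_eps_delta by (metis zero_less_one)
  \<comment> \<open>The cap 1 keeps \<open>t\<close> below \<open>pi\<close>, so
    \<open>sin t > 0\<close> and the two parameters differ.\<close>
  define t where "t = min (\<delta> / 2) 1"
  have t: "0 < t" "t \<le> 1" "dist t 0 < \<delta>" using \<delta>(1) by (auto simp: t_def)
  let ?c = "\<lambda>t. of_real \<epsilon> * exp (\<i> * of_real t) :: complex"
  have "sin t > 0" using t pi_gt3 by (intro sin_gt_zero) auto
  hence "exp (\<i> * of_real t) \<noteq> 1"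
    by (auto simp: complex_eq_iff Im_exp)
  hence "?c t \<noteq> ?c 0" using assms(2) by auto
  hence "1 \<le> norm (P t - P 0)"
    using norm_projection_diff_ge_1[of k \<epsilon> "?c t" "?c 0"] assms(1-3)
    by (simp add: assms(4) quotient_space_def norm_mult)
  with \<delta>(2)[OF t(3)] show False by (simp add: dist_norm)
qed

end
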